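(* Let $p$ be a prime, $k=GF(p)$, and let $G=G_{p,1}=C_p\wr\langle x\rangle$ be the restricted wreath product, where $C_p=\langle a\rangle$ has order $p$ and $\langle x\rangle$ is infinite cyclic. Suppose $H$ is a normal subgroup of $G$ of index $p$. Then every faithful state-closed representation of $G$ on the $p$-ary tree obtained with respect to $H$ is reducible to a representation $\varphi$ of the form $$\varphi: a\mapsto \alpha=(0,1,\dots,p-1),\qquad x\mapsto \xi=\left(\xi^{n},\ \xi^{n}\alpha^{u(\xi)},\ \dots,\ \xi^{n}\alpha^{u(\xi)i},\ \dots,\ \xi^{n}\alpha^{u(\xi)(p-1)}\right)$$ for some integer $n$ and some $u(x)\in k\langle x\rangle$ such that $\gcd(p,n)=1$ and $u(1)\neq 0$.
   Context: Restricted wreath product: $G=A\rtimes\langle x\rangle$, where $A=\bigoplus_{j\in\mathbb Z}\langle a^{x^j}\rangle$ is the normal closure of $\langle a\rangle$ and $g^h=h^{-1}gh$. $k\langle x\rangle$ is the group algebra over $k$ of the infinite cyclic group $\langle x\rangle$ (Laurent polynomials). For $u=\sum_j c_jx^j\in k\langle x\rangle$, $a^{u}=\prod_j (x^{-j}ax^{j})^{c_j}$, and likewise $\alpha^{u(\xi)}=\prod_j(\xi^{-j}\alpha\xi^{j})^{c_j}$ and $\alpha^{u(\xi)i}=(\alpha^{u(\xi)})^i$. Trees: an automorphism $g$ of the $p$-ary tree (vertices: finite sequences over $\{0,\dots,p-1\}$) is written $g=(g_0,\dots,g_{p-1})\sigma$, where $\sigma$ is the permutation induced on the first level and $g$ maps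 $iw$ to $i^\sigma w^{g_i}$. A permutation $\sigma$ of $\{0,\dots,p-1\}$ is identified with $(1,\dots,1)\sigma$, and if $\sigma$ is trivial it is omitted. A set of tree automorphisms given by such recursive equations is uniquely determined. State-closed groups are those containing all $g_i$ for each of their elements $g$. Representation from a similarity pair: let $H\le G$ have finite index $m$, let $f:H\to G$ be a homomorphism and let $T=\{t_0,\dots,t_{m-1}\}$ be a right transversal of $H$ in $G$. For $g\in G$ let $g^\sigma$ be the permutation of $\{0,\dots,m-1\}$ with $Ht_ig=Ht_{i^{g^\sigma}}$, and put $h_i=t_ig\,t_{i^{g^\sigma}}^{-1}\in H$. The associated state-closed representation $\varphi$ of $G$ on the $m$-ary tree is defined recursively by $g^\varphi=\left((h_0^f)^\varphi,\dots,(h_{m-1}^f)^\varphi\right)g^\sigma$. A representation "obtained with respect to $H$" is one associated in this way with some pair $(H,f)$; it is faithful if and only if $f$ is simple, i.e. the only subgroup $K\le H$ normal in $G$ with $K^f\le K$ is $K=1$. Reduction: put $X=\langle x\rangle$, $A_0=A\cap H$ (automatically $A_0^f\le A$) and $Y=AH\cap X$. For $y\in Y$ choose $v(y)\in A$ with $v(y)y\in H$, and write $(v(y)y)^f=w(y)y'$ with $w(y)\in A$, $y'\in X$. Then $y\mapsto y'$ is a well-defined homomorphism $Y\to X$. The pair $(H,f)$ may be replaced by $(\dot H,\dot f)$, where $\dot H=A_0Y$ and $\dot f:\dot H\to G$ is given by $(a_0y)^{\dot f}=a_0^{f}\,y'$ for $a_0\in A_0$, $y\in Y$. It may also be replaced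 by $(H^\gamma,f^\gamma)$, where $\gamma$ is an automorphism of $X$ extended to $G$ by fixing $a$, and $f^\gamma:h^\gamma\mapsto (h^f)^\gamma$. A representation obtained from $(H,f)$ is reducible to $\varphi$ if $\varphi$ is the representation associated (for some choice of right transversal) with a pair obtained from $(H,f)$ by such replacements. *)

theory Defs
  imports
    "HOL-Algebra.Algebra"
    "HOL-Number_Theory.Residues"
    "HOL-Combinatorics.Combinatorics"
    "HOL-Library.Sublist"
begin

section \<open>Restricted wreath products\<close>

text \<open>
  The pair \<open>(s, g)\<close> stands for the product \<open>s g\<close> with \<open>s\<close> in the base group and \<open>g\<close> in
  the top group. The coordinate \<open>j\<close> of the base group is the copy of \<open>B\<close> conjugated by
  \<open>j\<close>, that is \<open>b ^ j = inv j * b * j\<close>; therefore \<open>g t inv g\<close> has the entry \<open>t (j g)\<close> at \<open>j\<close>.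
\<close>

definition wreath_base :: "('b, 'c) monoid_scheme \<Rightarrow> ('q, 'd) monoid_scheme \<Rightarrow> ('q \<Rightarrow> 'b) monoid"
  where "wreath_base B Q = sum_group (carrier Q) (\<lambda>_. B)"

definition rwreath ::
    "('b, 'c) monoid_scheme \<Rightarrow> ('q, 'd) monoid_scheme \<Rightarrow> (('q \<Rightarrow> 'b) \<times> 'q) monoid"
  where "rwreath B Q =
    \<lparr>carrier = carrier (wreath_base B Q) \<times> carrier Q,
     monoid.mult = (\<lambda>(s, g) (t, h).
       (s \<otimes>\<^bsub>wreath_base B Q\<^esub> (\<lambda>j\<in>carrier Q. t (j \<otimes>\<^bsub>Q\<^esub> g)), g \<otimes>\<^bsub>Q\<^esub> h)),
     one = (\<one>\<^bsub>wreath_base B Q\<^esub>, \<one>\<^bsub>Q\<^esub>)\<rparr>"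

definition lamp :: "nat \<Rightarrow> ((int \<Rightarrow> int) \<times> int) monoid"
  where "lamp p = rwreath (integer_mod_group p) integer_group"

definition lamp_a :: "(int \<Rightarrow> int) \<times> int"
  where "lamp_a = ((\<lambda>j. if j = 0 then 1 else 0), 0)"

definition lamp_x :: "(int \<Rightarrow> int) \<times> int"
  where "lamp_x = ((\<lambda>j. 0), 1)"

definition lamp_A :: "nat \<Rightarrow> ((int \<Rightarrow> int) \<times> int) set"
  where "lamp_A p = carrier (wreath_base (integer_mod_group p) integer_group) \<times> {0}"

definition lamp_X :: "nat \<Rightarrow> ((int \<Rightarrow> int) \<times> int) set"
  where "lamp_X p = generate (lamp p) {lamp_x}"


section \<open>Elements of the group algebra of an infinite cyclic group\<close>

definition laurent :: "('k, 'c) ring_scheme \<Rightarrow> (int \<Rightarrow> 'k) set"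
  where "laurent K = {c. (\<forall>j. c j \<in> carrier K) \<and> finite {j. c j \<noteq> \<zero>\<^bsub>K\<^esub>}}"

definition laurent_at_one :: "('k, 'c) ring_scheme \<Rightarrow> (int \<Rightarrow> 'k) \<Rightarrow> 'k"
  where "laurent_at_one K c = finsum K c {j. c j \<noteq> \<zero>\<^bsub>K\<^esub>}"

text \<open>
  The element \<open>b\<close> raised to \<open>u(y)\<close>, where \<open>u\<close> has coefficients in \<open>residue_ring p\<close>, whose
  carrier consists of the integers \<open>0, \<dots>, p - 1\<close>; these are used as exponents. The factors
  are multiplied in increasing order of \<open>j\<close>, which is immaterial when the conjugates commute.
\<close>

definition laurent_pow :: "('g, 'c) monoid_scheme \<Rightarrow> 'g \<Rightarrow> 'g \<Rightarrow> (int \<Rightarrow> int) \<Rightarrow> 'g"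
  where "laurent_pow G b y c =
    foldr (\<lambda>j r. (y [^]\<^bsub>G\<^esub> (- j) \<otimes>\<^bsub>G\<^esub> b \<otimes>\<^bsub>G\<^esub> y [^]\<^bsub>G\<^esub> j) [^]\<^bsub>G\<^esub> c j \<otimes>\<^bsub>G\<^esub> r)
      (sorted_list_of_set {j. c j \<noteq> 0}) \<one>\<^bsub>G\<^esub>"


section \<open>Automorphisms of the \<open>m\<close>-ary tree\<close>

text \<open>Automorphisms act on the right, so \<open>g \<otimes> h\<close> applies \<open>g\<close> first.\<close>

definition tree_aut :: "nat \<Rightarrow> (nat list \<Rightarrow> nat list) monoid"
  where "tree_aut m =
    \<lparr>carrier = {g. g permutes lists {..<m} \<and>
       (\<forall>v\<in>lists {..<m}. \<forall>w\<in>lists {..<m}. prefix (g v) (g w) \<longleftrightarrow> prefix v w)},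
     monoid.mult = (\<lambda>g h. h \<circ> g),
     one = id\<rparr>"

definition tree_node :: "nat \<Rightarrow> (nat \<Rightarrow> nat list \<Rightarrow> nat list) \<Rightarrow> (nat \<Rightarrow> nat) \<Rightarrow> nat list \<Rightarrow> nat list"
  where "tree_node m c \<sigma> w =
    (case w of [] \<Rightarrow> [] | i # v \<Rightarrow> if w \<in> lists {..<m} then \<sigma> i # c i v else w)"

definition rooted_cycle :: "nat \<Rightarrow> nat list \<Rightarrow> nat list"
  where "rooted_cycle m = tree_node m (\<lambda>_. \<one>\<^bsub>tree_aut m\<^esub>) (cycle_of_list [0..<m])"


section \<open>State-closed representations\<close>

definition similarity_pair ::
    "('g, 'c) monoid_scheme \<Rightarrow> nat \<Rightarrow> 'g set \<Rightarrow> ('g \<Rightarrow> 'g) \<Rightarrow> bool"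
  where "similarity_pair G m H f \<longleftrightarrow>
    subgroup H G \<and> finite (rcosets\<^bsub>G\<^esub> H) \<and> card (rcosets\<^bsub>G\<^esub> H) = m \<and>
    f \<in> hom (G\<lparr>carrier := H\<rparr>) G"

definition right_transversal ::
    "('g, 'c) monoid_scheme \<Rightarrow> nat \<Rightarrow> 'g set \<Rightarrow> (nat \<Rightarrow> 'g) \<Rightarrow> bool"
  where "right_transversal G m H t \<longleftrightarrow>
    t ` {..<m} \<subseteq> carrier G \<and> bij_betw (\<lambda>i. H #>\<^bsub>G\<^esub> t i) {..<m} (rcosets\<^bsub>G\<^esub> H)"

definition coset_perm ::
    "('g, 'c) monoid_scheme \<Rightarrow> nat \<Rightarrow> 'g set \<Rightarrow> (nat \<Rightarrow> 'g) \<Rightarrow> 'g \<Rightarrow> nat \<Rightarrow> nat"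
  where "coset_perm G m H t g i =
    (if i < m then THE j. j < m \<and> H #>\<^bsub>G\<^esub> (t i \<otimes>\<^bsub>G\<^esub> g) = H #>\<^bsub>G\<^esub> t j else i)"

definition coset_cocycle ::
    "('g, 'c) monoid_scheme \<Rightarrow> nat \<Rightarrow> 'g set \<Rightarrow> (nat \<Rightarrow> 'g) \<Rightarrow> 'g \<Rightarrow> nat \<Rightarrow> 'g"
  where "coset_cocycle G m H t g i =
    t i \<otimes>\<^bsub>G\<^esub> g \<otimes>\<^bsub>G\<^esub> inv\<^bsub>G\<^esub> (t (coset_perm G m H t g i))"

primrec sc_act ::
    "('g, 'c) monoid_scheme \<Rightarrow> nat \<Rightarrow> 'g set \<Rightarrow> ('g \<Rightarrow> 'g) \<Rightarrow> (nat \<Rightarrow> 'g) \<Rightarrow> nat list \<Rightarrow> 'g \<Rightarrow> nat list"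
  where
    "sc_act G m H f t [] g = []"
  | "sc_act G m H f t (i # v) g =
       coset_perm G m H t g i # sc_act G m H f t v (f (coset_cocycle G m H t g i))"

definition sc_rep ::
    "('g, 'c) monoid_scheme \<Rightarrow> nat \<Rightarrow> 'g set \<Rightarrow> ('g \<Rightarrow> 'g) \<Rightarrow> (nat \<Rightarrow> 'g) \<Rightarrow> 'g \<Rightarrow> nat list \<Rightarrow> nat list"
  where "sc_rep G m H f t g w = (if w \<in> lists {..<m} then sc_act G m H f t w g else w)"

lemma sc_rep_rec:
  "sc_rep G m H f t g =
     tree_node m (\<lambda>i. sc_rep G m H f t (f (coset_cocycle G m H t g i))) (coset_perm G m H t g)"
  by (auto simp: sc_rep_def tree_node_def fun_eq_iff split: list.splits)


section \<open>Reduction of similarity pairs\<close>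

text \<open>
  Only the values of \<open>f'\<close> on \<open>H'\<close> matter. For \<open>y\<close> in \<open>Y = A H \<inter> C\<close> the element \<open>y'\<close> below is the
  image of \<open>y\<close> under the homomorphism from \<open>Y\<close> to \<open>C\<close> induced by \<open>f\<close>.
\<close>

inductive pair_reduction ::
    "('g, 'c) monoid_scheme \<Rightarrow> 'g set \<Rightarrow> 'g set \<Rightarrow> 'g \<Rightarrow>
     'g set \<Rightarrow> ('g \<Rightarrow> 'g) \<Rightarrow> 'g set \<Rightarrow> ('g \<Rightarrow> 'g) \<Rightarrow> bool"
  for G A C a H f
  where
    refl: "pair_reduction G A C a H f H f"
  | split: "pair_reduction G A C a H f H' f''"
      if "pair_reduction G A C a H f H1 f1"
        and "H' = (A \<inter> H1) <#>\<^bsub>G\<^esub> ((A <#>\<^bsub>G\<^esub> H1) \<inter> C)"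
        and "\<And>a0 y v w y'. \<lbrakk>a0 \<in> A \<inter> H1; y \<in> (A <#>\<^bsub>G\<^esub> H1) \<inter> C; v \<in> A; v \<otimes>\<^bsub>G\<^esub> y \<in> H1;
               w \<in> A; y' \<in> C; f1 (v \<otimes>\<^bsub>G\<^esub> y) = w \<otimes>\<^bsub>G\<^esub> y'\<rbrakk>
               \<Longrightarrow> f'' (a0 \<otimes>\<^bsub>G\<^esub> y) = f1 a0 \<otimes>\<^bsub>G\<^esub> y'"
  | twist: "pair_reduction G A C a H f H' f''"
      if "pair_reduction G A C a H f H1 f1"
        and "\<gamma> \<in> iso G G" and "\<gamma> ` C = C" and "\<gamma> a = a"
        and "H' = \<gamma> ` H1"
        and "\<And>h. h \<in> H1 \<Longrightarrow> f'' (\<gamma> h) = \<gamma> (f1 h)"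

definition reducible_to ::
    "('g, 'c) monoid_scheme \<Rightarrow> 'g set \<Rightarrow> 'g set \<Rightarrow> 'g \<Rightarrow> nat \<Rightarrow>
     'g set \<Rightarrow> ('g \<Rightarrow> 'g) \<Rightarrow> ('g \<Rightarrow> nat list \<Rightarrow> nat list) \<Rightarrow> bool"
  where "reducible_to G A C a m H f \<phi> \<longleftrightarrow>
    (\<exists>H' f' t'. pair_reduction G A C a H f H' f' \<and>
       similarity_pair G m H' f' \<and> right_transversal G m H' t' \<and>
       (\<forall>g\<in>carrier G. \<phi> g = sc_rep G m H' f' t' g))"


section \<open>Basic properties\<close>

lemma tree_aut_group: "group (tree_aut m)"
proof (rule groupI)
  show "\<one>\<^bsub>tree_aut m\<^esub> \<in> carrier (tree_aut m)"
    by (auto simp: tree_aut_def permutes_id)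
next
  fix g h assume "g \<in> carrier (tree_aut m)" "h \<in> carrier (tree_aut m)"
  then show "g \<otimes>\<^bsub>tree_aut m\<^esub> h \<in> carrier (tree_aut m)"
    by (auto simp: tree_aut_def permutes_compose permutes_in_image simp del: in_lists_conv_set)
next
  fix g assume g: "g \<in> carrier (tree_aut m)"
  then have p: "g permutes lists {..<m}" by (simp add: tree_aut_def)
  have "prefix (inv_into UNIV g v) (inv_into UNIV g w) \<longleftrightarrow> prefix v w"
    if "v \<in> lists {..<m}" "w \<in> lists {..<m}" for v w
  proof -
    have "inv_into UNIV g v \<in> lists {..<m}" "inv_into UNIV g w \<in> lists {..<m}"
      using that permutes_in_image[OF permutes_inv[OF p]] by auto
    then show ?thesis
      using g permutes_inverses(1)[OF p] by (simp add: tree_aut_def del: in_lists_conv_set) metis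
  qed
  then have "inv_into UNIV g \<in> carrier (tree_aut m)"
    using permutes_inv[OF p] by (simp add: tree_aut_def)
  moreover have "inv_into UNIV g \<otimes>\<^bsub>tree_aut m\<^esub> g = \<one>\<^bsub>tree_aut m\<^esub>"
    using permutes_inv_o(1)[OF p] by (simp add: tree_aut_def)
  ultimately show "\<exists>h\<in>carrier (tree_aut m). h \<otimes>\<^bsub>tree_aut m\<^esub> g = \<one>\<^bsub>tree_aut m\<^esub>" by blast
qed (auto simp: tree_aut_def)

lemma carrier_wreath_base:
  assumes "group B"
  shows "carrier (wreath_base B Q) =
    {s \<in> carrier Q \<rightarrow>\<^sub>E carrier B. finite {j \<in> carrier Q. s j \<noteq> \<one>\<^bsub>B\<^esub>}}"
  using assms by (simp add: wreath_base_def carrier_sum_group)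

lemma rwreath_group:
  assumes B: "group B" and Q: "group Q"
  shows "group (rwreath B Q)"
proof -
  interpret B: group B by fact
  interpret Q: group Q by fact
  define S where "S = wreath_base B Q"
  interpret S: group S by (simp add: S_def wreath_base_def B)
  have cS: "s \<in> carrier S \<longleftrightarrow>
      s \<in> carrier Q \<rightarrow>\<^sub>E carrier B \<and> finite {j \<in> carrier Q. s j \<noteq> \<one>\<^bsub>B\<^esub>}" for s
    by (simp add: S_def carrier_wreath_base B)
  have mS: "s \<otimes>\<^bsub>S\<^esub> t = (\<lambda>j\<in>carrier Q. s j \<otimes>\<^bsub>B\<^esub> t j)" for s t
    by (simp add: S_def wreath_base_def)
  have oS: "\<one>\<^bsub>S\<^esub> = (\<lambda>j\<in>carrier Q. \<one>\<^bsub>B\<^esub>)"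
    by (simp add: S_def wreath_base_def)
  define sh where "sh g t = (\<lambda>j\<in>carrier Q. t (j \<otimes>\<^bsub>Q\<^esub> g))" for g and t :: "'c \<Rightarrow> 'a"
  have shc: "sh g t \<in> carrier S" if "g \<in> carrier Q" "t \<in> carrier S" for g t
  proof -
    have "{j \<in> carrier Q. sh g t j \<noteq> \<one>\<^bsub>B\<^esub>} \<subseteq>
        (\<lambda>i. i \<otimes>\<^bsub>Q\<^esub> inv\<^bsub>Q\<^esub> g) ` {j \<in> carrier Q. t j \<noteq> \<one>\<^bsub>B\<^esub>}"
    proof
      fix j assume "j \<in> {j \<in> carrier Q. sh g t j \<noteq> \<one>\<^bsub>B\<^esub>}"
      then show "j \<in> (\<lambda>i. i \<otimes>\<^bsub>Q\<^esub> inv\<^bsub>Q\<^esub> g) ` {j \<in> carrier Q. t j \<noteq> \<one>\<^bsub>B\<^esub>}"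
        using that by (intro image_eqI[of _ _ "j \<otimes>\<^bsub>Q\<^esub> g"]) (auto simp: sh_def Q.m_assoc)
    qed
    then have "finite {j \<in> carrier Q. sh g t j \<noteq> \<one>\<^bsub>B\<^esub>}"
      by (rule finite_subset) (use that(2) in \<open>simp add: cS\<close>)
    moreover have "sh g t \<in> carrier Q \<rightarrow>\<^sub>E carrier B"
      using that by (auto simp: sh_def cS)
    ultimately show ?thesis by (simp add: cS)
  qed
  have shm: "sh g (s \<otimes>\<^bsub>S\<^esub> t) = sh g s \<otimes>\<^bsub>S\<^esub> sh g t" if "g \<in> carrier Q" for g s t
    using that by (auto simp: sh_def mS fun_eq_iff)
  have shsh: "sh g (sh h t) = sh (g \<otimes>\<^bsub>Q\<^esub> h) t" if "g \<in> carrier Q" "h \<in> carrier Q" for g h t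
    using that by (auto simp: sh_def fun_eq_iff Q.m_assoc)
  have sh1: "sh \<one>\<^bsub>Q\<^esub> t = t" if "t \<in> carrier S" for t
    using that by (auto simp: sh_def fun_eq_iff cS PiE_iff extensional_def)
  have sho: "sh g \<one>\<^bsub>S\<^esub> = \<one>\<^bsub>S\<^esub>" if "g \<in> carrier Q" for g
    using that by (auto simp: sh_def fun_eq_iff oS)
  have W: "rwreath B Q = \<lparr>carrier = carrier S \<times> carrier Q,
      monoid.mult = (\<lambda>(s, g) (t, h). (s \<otimes>\<^bsub>S\<^esub> sh g t, g \<otimes>\<^bsub>Q\<^esub> h)), one = (\<one>\<^bsub>S\<^esub>, \<one>\<^bsub>Q\<^esub>)\<rparr>"
    by (simp add: rwreath_def S_def sh_def)
  show ?thesis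
  proof (rule groupI)
    fix g assume "g \<in> carrier (rwreath B Q)"
    then obtain s q where g: "g = (s, q)" "s \<in> carrier S" "q \<in> carrier Q" by (auto simp: W)
    have "(sh (inv\<^bsub>Q\<^esub> q) (inv\<^bsub>S\<^esub> s), inv\<^bsub>Q\<^esub> q) \<otimes>\<^bsub>rwreath B Q\<^esub> g = \<one>\<^bsub>rwreath B Q\<^esub>"
      using g by (simp add: W shm[symmetric] sho)
    then show "\<exists>h\<in>carrier (rwreath B Q). h \<otimes>\<^bsub>rwreath B Q\<^esub> g = \<one>\<^bsub>rwreath B Q\<^esub>"
      using g by (intro bexI[of _ "(sh (inv\<^bsub>Q\<^esub> q) (inv\<^bsub>S\<^esub> s), inv\<^bsub>Q\<^esub> q)"]) (auto simp: W shc)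
  qed (auto simp: W shc shm shsh sh1 sho S.m_assoc Q.m_assoc)
qed

lemma lamp_group: "group (lamp p)"
  by (simp add: lamp_def rwreath_group)

lemma coset_perm_cocycle:
  fixes G (structure)
  assumes G: "group G" and sp: "similarity_pair G m H f" and rt: "right_transversal G m H t"
    and i: "i < m" and g: "g \<in> carrier G"
  shows "coset_perm G m H t g i < m"
    and "H #>\<^bsub>G\<^esub> (t i \<otimes>\<^bsub>G\<^esub> g) = H #>\<^bsub>G\<^esub> t (coset_perm G m H t g i)"
    and "coset_cocycle G m H t g i \<in> H"
proof -
  interpret group G by fact
  have H: "subgroup H G" using sp by (simp add: similarity_pair_def)
  have tc: "t j \<in> carrier G" if "j < m" for j
    using rt that by (auto simp: right_transversal_def)
  have bij: "bij_betw (\<lambda>i. H #> t i) {..<m} (rcosets H)"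
    using rt by (simp add: right_transversal_def)
  have "H #> (t i \<otimes> g) \<in> rcosets H"
    using tc[OF i] g by (auto simp: RCOSETS_def)
  then obtain j where j: "j < m" "H #> (t i \<otimes> g) = H #> t j"
    using bij by (auto simp: bij_betw_def)
  have "coset_perm G m H t g i = j"
    unfolding coset_perm_def using i
    by (auto intro!: the_equality j dest: inj_onD[OF bij_betw_imp_inj_on[OF bij]] simp: j)
  then show *: "coset_perm G m H t g i < m"
    and **: "H #> (t i \<otimes> g) = H #> t (coset_perm G m H t g i)"
    using j by auto
  have "t i \<otimes> g \<in> H #> t (coset_perm G m H t g i)"
    using ** rcos_self[OF _ H, of "t i \<otimes> g"] tc[OF i] g by simp
  then obtain h where h: "h \<in> H" "t i \<otimes> g = h \<otimes> t (coset_perm G m H t g i)"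
    by (auto simp: r_coset_def)
  then have "coset_cocycle G m H t g i = h"
    using tc[OF *] subgroup.mem_carrier[OF H h(1)] by (simp add: coset_cocycle_def m_assoc)
  then show "coset_cocycle G m H t g i \<in> H" using h by simp
qed

lemma sc_rep_hom:
  fixes G (structure)
  assumes G: "group G" and sp: "similarity_pair G m H f" and rt: "right_transversal G m H t"
  shows "sc_rep G m H f t \<in> hom G (tree_aut m)"
proof -
  interpret group G by fact
  have H: "subgroup H G" and f: "f \<in> hom (G\<lparr>carrier := H\<rparr>) G"
    using sp by (auto simp: similarity_pair_def)
  note pc = coset_perm_cocycle[OF G sp rt]
  have tc: "t j \<in> carrier G" if "j < m" for j
    using rt that by (auto simp: right_transversal_def)
  have inj: "i = j" if "H #> t i = H #> t j" "i < m" "j < m" for i j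
    using rt that by (auto simp: right_transversal_def bij_betw_def inj_on_def)
  have fc: "f h \<in> carrier G" if "h \<in> H" for h
    using f that by (auto simp: hom_def)
  have fm: "f (h \<otimes> k) = f h \<otimes> f k" if "h \<in> H" "k \<in> H" for h k
    using f that by (auto simp: hom_def)
  have f1: "f \<one> = \<one>"
    using fm[of \<one> \<one>] fc[of \<one>] subgroup.one_closed[OF H] by simp
  have perm_mult: "coset_perm G m H t (g \<otimes> h) i = coset_perm G m H t h (coset_perm G m H t g i)"
    if "g \<in> carrier G" "h \<in> carrier G" "i < m" for g h i
  proof (rule inj)
    let ?j = "coset_perm G m H t g i"
    have "H #> t (coset_perm G m H t (g \<otimes> h) i) = H #> (t i \<otimes> g \<otimes> h)"
      using pc(2)[of i "g \<otimes> h"] that tc by (simp add: m_assoc)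
    also have "\<dots> = (H #> (t i \<otimes> g)) #> h"
      using that tc subgroup.subset[OF H] by (simp add: coset_mult_assoc)
    also have "\<dots> = H #> (t ?j \<otimes> h)"
      using that tc subgroup.subset[OF H] pc by (simp add: coset_mult_assoc)
    finally show "H #> t (coset_perm G m H t (g \<otimes> h) i) = H #> t (coset_perm G m H t h ?j)"
      using pc that by simp
  qed (use that pc in auto)
  have coc_mult: "coset_cocycle G m H t (g \<otimes> h) i =
      coset_cocycle G m H t g i \<otimes> coset_cocycle G m H t h (coset_perm G m H t g i)"
    if "g \<in> carrier G" "h \<in> carrier G" "i < m" for g h i
  proof -
    let ?j = "coset_perm G m H t g i"
    let ?k = "coset_perm G m H t h ?j"
    have c: "t i \<in> carrier G" "t ?j \<in> carrier G" "t ?k \<in> carrier G"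
      using that pc tc by auto
    have e: "inv (t ?j) \<otimes> (t ?j \<otimes> z) = z" if "z \<in> carrier G" for z
      using c that by (simp add: m_assoc[symmetric])
    have "t i \<otimes> (g \<otimes> h) \<otimes> inv (t ?k) = t i \<otimes> g \<otimes> inv (t ?j) \<otimes> (t ?j \<otimes> h \<otimes> inv (t ?k))"
      using c that e by (simp add: m_assoc)
    then show ?thesis using that by (simp add: coset_cocycle_def perm_mult)
  qed
  have perm_1: "coset_perm G m H t \<one> i = i" if "i < m" for i
    using pc(1,2)[OF that one_closed] tc[OF that] that by (intro inj) auto
  have act_words: "sc_act G m H f t v g \<in> lists {..<m}"
    if "v \<in> lists {..<m}" "g \<in> carrier G" for v g
    using that by (induction v arbitrary: g) (auto simp: pc fc)
  have act_mult: "sc_act G m H f t v (g \<otimes> h) = sc_act G m H f t (sc_act G m H f t v g) h"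
    if "v \<in> lists {..<m}" "g \<in> carrier G" "h \<in> carrier G" for v g h
    using that by (induction v arbitrary: g h) (auto simp: pc fc fm perm_mult coc_mult)
  have act_1: "sc_act G m H f t v \<one> = v" if "v \<in> lists {..<m}" for v
    using that by (induction v) (auto simp: perm_1 coset_cocycle_def tc f1)
  have act_prefix: "prefix (sc_act G m H f t v g) (sc_act G m H f t w g)" if "prefix v w" for v w g
  proof -
    have "prefix (sc_act G m H f t v g) (sc_act G m H f t (v @ u) g)" for u
      by (induction v arbitrary: g) auto
    then show ?thesis using that by (auto elim: prefixE)
  qed
  let ?r = "sc_rep G m H f t"
  have r_mult: "?r (g \<otimes> h) = ?r h \<circ> ?r g" if "g \<in> carrier G" "h \<in> carrier G" for g h
    using that act_words act_mult by (auto simp: sc_rep_def fun_eq_iff simp del: in_lists_conv_set)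
  have r_1: "?r \<one> = id"
    using act_1 by (auto simp: sc_rep_def fun_eq_iff simp del: in_lists_conv_set)
  have r_prefix: "prefix (?r g v) (?r g w)"
    if "prefix v w" "v \<in> lists {..<m}" "w \<in> lists {..<m}" for g v w
    using act_prefix[OF that(1)] that by (simp add: sc_rep_def del: in_lists_conv_set)
  have r_words: "?r g v \<in> lists {..<m}" if "v \<in> lists {..<m}" "g \<in> carrier G" for g v
    using that act_words by (simp add: sc_rep_def del: in_lists_conv_set)
  have r_aut: "?r g \<in> carrier (tree_aut m)" if g: "g \<in> carrier G" for g
  proof -
    have inv1: "?r (inv g) (?r g w) = w" and inv2: "?r g (?r (inv g) w) = w" for w
      using r_mult[of g "inv g"] r_mult[of "inv g" g] g r_1 by (auto simp: fun_eq_iff)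
    have "\<exists>!w. ?r g w = v" for v
      by (rule ex1I[of _ "?r (inv g) v"]) (use inv1 inv2 in auto)
    moreover have "?r g w = w" if "w \<notin> lists {..<m}" for w
      using that by (simp only: sc_rep_def if_False)
    ultimately have perm: "?r g permutes lists {..<m}"
      unfolding permutes_def by blast
    have "prefix (?r g v) (?r g w) \<longleftrightarrow> prefix v w"
      if "v \<in> lists {..<m}" "w \<in> lists {..<m}" for v w
      using r_prefix[of v w g] r_prefix[of "?r g v" "?r g w" "inv g"] r_words[OF _ g] that inv1 by metis
    with perm show ?thesis
      unfolding tree_aut_def by simp
  qed
  show ?thesis
    by (rule homI) (auto simp: r_aut r_mult, simp add: tree_aut_def)
qed

lemma carrier_lamp: "carrier (lamp p) = carrier (wreath_base (integer_mod_group p) integer_group) \<times> UNIV"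
  by (simp add: lamp_def rwreath_def)

lemma lamp_mult: "(s, m) \<otimes>\<^bsub>lamp p\<^esub> (t, n) = ((\<lambda>j. (s j + t (j + m)) mod int p), m + n)"
  by (simp add: lamp_def rwreath_def wreath_base_def restrict_def)

lemma lamp_x_pow:
  assumes "p > 1"
  shows "lamp_x [^]\<^bsub>lamp p\<^esub> (n :: int) = ((\<lambda>j. 0), n)"
proof -
  have h: "(\<lambda>n. ((\<lambda>j. 0), n)) \<in> hom integer_group (lamp p)"
    using assms
    by (intro homI) (auto simp: carrier_lamp carrier_wreath_base lamp_mult carrier_integer_mod_group)
  have "((\<lambda>j. 0), (1::int) [^]\<^bsub>integer_group\<^esub> n) = ((\<lambda>j. 0), 1) [^]\<^bsub>lamp p\<^esub> n"
    by (rule hom_int_pow[OF h]) (simp_all add: lamp_group)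
  then show ?thesis
    by (simp add: lamp_x_def)
qed

lemma lamp_conj:
  assumes "p > 1"
  shows "lamp_x [^]\<^bsub>lamp p\<^esub> (- n :: int) \<otimes>\<^bsub>lamp p\<^esub> lamp_a \<otimes>\<^bsub>lamp p\<^esub> lamp_x [^]\<^bsub>lamp p\<^esub> n =
     ((\<lambda>j. if j = n then 1 else 0), 0)"
  using assms by (auto simp: lamp_x_pow lamp_a_def lamp_mult fun_eq_iff)

lemma lamp_X_eq:
  assumes "p > 1"
  shows "lamp_X p = {(\<lambda>j. 0)} \<times> UNIV"
proof -
  have "lamp_x \<in> carrier (lamp p)"
    using assms by (auto simp: carrier_lamp carrier_wreath_base carrier_integer_mod_group lamp_x_def)
  then show ?thesis
    using assms by (auto simp: lamp_X_def group.generate_pow[OF lamp_group] lamp_x_pow)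
qed

end

theory Submission
  imports Defs
begin

text \<open>
  Identify \<open>A\<close> with the Laurent polynomials over \<open>GF(p)\<close>. The group \<open>G / H\<close> has prime order, hence
  is abelian, so \<open>H\<close> contains the augmentation ideal \<open>(x - 1) A\<close>; as \<open>A \<le> H\<close> would make \<open>A\<close> an
  \<open>f\<close>-invariant normal subgroup, \<open>A \<inter> H = (x - 1) A\<close> and \<open>A H = G\<close>. The restriction of \<open>f\<close> to
  \<open>(x - 1) A\<close> sends \<open>(x - 1) r(x)\<close> to \<open>r(x\<^sup>n) u(x)\<close>, where \<open>n\<close> is the action on the top group and
  \<open>u = (x - 1)\<^sup>f\<close>. If \<open>u(1) = 0\<close>, then \<open>(x - 1) A\<close> is \<open>f\<close>-invariant, and if \<open>p\<close> divides \<open>n\<close>, then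
  \<open>(x - 1)\<^sup>2 A\<close> is; both are excluded by faithfulness. Splitting off the top group leaves the pair
  \<open>((x - 1) A X, f')\<close>, whose representation with respect to the transversal \<open>1, a, \<dots>, a ^ (p - 1)\<close>
  is the required one, because \<open>a ^ i x = x (a ^ (x - 1)) ^ i a ^ i\<close>.
\<close>

section \<open>Groups and state-closed representations\<close>

text \<open>The order of a nontrivial element divides the prime group order, so such an element
  generates the group and every other element is a power of it.\<close>

lemma (in group) prime_order_comm:
  assumes "Factorial_Ring.prime (Coset.order G)" "x \<in> carrier G" "y \<in> carrier G"
  shows "x \<otimes> y = y \<otimes> x"
proof (cases "x = \<one>")
  case False
  have fin: "finite (carrier G)"
    using assms(1) by (metis card.infinite Coset.order_def not_prime_0)
  have "ord x dvd Coset.order G" using assms(2) by (rule ord_dvd_group_order)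
  moreover have "ord x \<noteq> 1" using False assms(2) ord_eq_1 by blast
  ultimately have "ord x = Coset.order G"
    using assms(1) by (auto simp: prime_nat_iff)
  then have "card (generate G {x}) = card (carrier G)"
    using generate_pow_card[OF assms(2)] by (simp add: Coset.order_def)
  moreover have "generate G {x} \<subseteq> carrier G"
    using generate_incl[of "{x}"] assms(2) by simp
  ultimately have "generate G {x} = carrier G"
    using fin card_subset_eq by blast
  then obtain k :: int where "y = x [^] k"
    using assms(2,3) generate_pow[OF assms(2)] by auto
  then show ?thesis
    using assms(2) int_pow_mult[of x 1 k] int_pow_mult[of x k 1]
    by (simp add: add.commute[of 1 k] int_pow_1)
qed (use assms in simp)

text \<open>The quotient is abelian by \<open>prime_order_comm\<close>, so \<open>x y\<close> and
  \<open>y x\<close> lie in one coset. Later this places the generators of \<open>(x - 1) A\<close>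
  in \<open>H\<close>.\<close>

lemma (in normal) commutator_mem_of_prime_index:
  assumes "Factorial_Ring.prime (card (rcosets H))" "x \<in> carrier G" "y \<in> carrier G"
  shows "x \<otimes> y \<otimes> inv (y \<otimes> x) \<in> H"
proof -
  interpret Q: group "G Mod H" by (rule factorgroup_is_group)
  have "(H #> x) \<otimes>\<^bsub>G Mod H\<^esub> (H #> y) = (H #> y) \<otimes>\<^bsub>G Mod H\<^esub> (H #> x)"
    using assms by (intro Q.prime_order_comm) (auto simp: Coset.order_def FactGroup_def RCOSETS_def)
  then have "H #> (x \<otimes> y) = H #> (y \<otimes> x)"
    using assms by (simp add: FactGroup_def rcos_sum)
  then show ?thesis
    using assms rcos_self[of "x \<otimes> y" H] subgroup_axioms by (auto intro!: rcos_module_imp)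
qed

lemma (in group_hom) kernel_rcos_eq_iff:
  assumes "x \<in> carrier G" "y \<in> carrier G"
  shows "kernel G H h #>\<^bsub>G\<^esub> x = kernel G H h #>\<^bsub>G\<^esub> y \<longleftrightarrow> h x = h y"
proof -
  interpret K: subgroup "kernel G H h" G by (rule subgroup_kernel)
  have "kernel G H h #>\<^bsub>G\<^esub> x = kernel G H h #>\<^bsub>G\<^esub> y \<longleftrightarrow> x \<in> kernel G H h #>\<^bsub>G\<^esub> y"
    using assms G.rcos_self[OF assms(1) subgroup_kernel] G.repr_independence[OF _ _ subgroup_kernel]
    by blast
  also have "\<dots> \<longleftrightarrow> x \<otimes>\<^bsub>G\<^esub> inv\<^bsub>G\<^esub> y \<in> kernel G H h"
    using assms by (intro K.rcos_module G.is_group)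
  also have "\<dots> \<longleftrightarrow> h x \<otimes>\<^bsub>H\<^esub> inv\<^bsub>H\<^esub> h y = \<one>\<^bsub>H\<^esub>"
  proof -
    have "h (x \<otimes>\<^bsub>G\<^esub> inv\<^bsub>G\<^esub> y) = h x \<otimes>\<^bsub>H\<^esub> inv\<^bsub>H\<^esub> h y"
      using assms by (simp only: hom_mult hom_inv G.inv_closed)
    then show ?thesis
      using assms by (simp only: kernel_def mem_Collect_eq G.m_closed G.inv_closed simp_thms)
  qed
  also have "\<dots> \<longleftrightarrow> h x = h y"
  proof
    assume "h x \<otimes>\<^bsub>H\<^esub> inv\<^bsub>H\<^esub> h y = \<one>\<^bsub>H\<^esub>"
    then have "inv\<^bsub>H\<^esub> (inv\<^bsub>H\<^esub> h y) = h x"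
      using assms by (intro H.inv_equality) auto
    then show "h x = h y" using assms by simp
  qed (use assms in simp)
  finally show ?thesis .
qed

text \<open>Since \<open>K\<close> is normal and inside \<open>H\<close>, it fixes every coset of
  \<open>H\<close>, and its cocycles are conjugates of its own elements. Applying \<open>f\<close>
  stays in \<open>K\<close>, so by induction along words \<open>K\<close> fixes the whole tree;
  injectivity then leaves only the identity.\<close>

lemma sc_rep_faithful_imp_simple:
  fixes G (structure)
  assumes G: "group G" and sp: "similarity_pair G m H f" and rt: "right_transversal G m H t"
    and inj: "inj_on (sc_rep G m H f t) (carrier G)"
    and K: "K \<lhd> G" "K \<subseteq> H" "f ` K \<subseteq> K"
  shows "K = {\<one>}"
proof -
  interpret K: normal K G by fact
  note pc = coset_perm_cocycle[OF G sp rt]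
  have H: "subgroup H G" using sp by (simp add: similarity_pair_def)
  have tc: "t j \<in> carrier G" if "j < m" for j
    using rt that by (auto simp: right_transversal_def)
  have one_K: "\<one> \<in> K" by (rule subgroup.one_closed) (rule K.subgroup_axioms)
  have perm: "coset_perm G m H t k i = i" if "k \<in> K" "i < m" for k i
  proof -
    have "t i \<otimes> k \<otimes> inv (t i) \<in> H"
      using that tc K(2) K.inv_op_closed2 by blast
    then have "H #> (t i \<otimes> k) = H #> t i"
      using subgroup.rcos_module_rev[OF H K.is_group, of "t i" "t i \<otimes> k"] that tc
        K.repr_independence[OF _ _ H] by auto
    then have "H #> t (coset_perm G m H t k i) = H #> t i"
      using pc(2)[of i k] that by simp
    then show ?thesis
      using rt that pc(1)[of i k] by (auto simp: right_transversal_def bij_betw_def inj_on_def)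
  qed
  have act: "sc_act G m H f t v k = v" if "k \<in> K" "v \<in> lists {..<m}" for v k
    using that(2,1)
  proof (induction v arbitrary: k rule: lists.induct)
    case (Cons i v)
    have "coset_cocycle G m H t k i \<in> K"
      using Cons perm tc K.inv_op_closed2 by (auto simp: coset_cocycle_def)
    then show ?case using Cons perm K(3) by auto
  qed auto
  have "k = \<one>" if "k \<in> K" for k
  proof (rule inj_onD[OF inj])
    show "sc_rep G m H f t k = sc_rep G m H f t \<one>"
      using act[OF that] act[OF one_K] by (intro ext) (simp only: sc_rep_def cong: if_cong)
  qed (use that in auto)
  then show ?thesis using one_K by blast
qed

lemma laurent_pow_hom:
  assumes "h \<in> hom G G'" "group G" "group G'" "b \<in> carrier G" "y \<in> carrier G"
  shows "h (laurent_pow G b y c) = laurent_pow G' (h b) (h y) c"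
proof -
  interpret group_hom G G' h by (simp add: assms group_hom_def group_hom_axioms_def)
  let ?F = "\<lambda>j r. (y [^]\<^bsub>G\<^esub> (- j) \<otimes>\<^bsub>G\<^esub> b \<otimes>\<^bsub>G\<^esub> y [^]\<^bsub>G\<^esub> j) [^]\<^bsub>G\<^esub> c j \<otimes>\<^bsub>G\<^esub> r"
  let ?F' = "\<lambda>j r. (h y [^]\<^bsub>G'\<^esub> (- j) \<otimes>\<^bsub>G'\<^esub> h b \<otimes>\<^bsub>G'\<^esub> h y [^]\<^bsub>G'\<^esub> j) [^]\<^bsub>G'\<^esub> c j \<otimes>\<^bsub>G'\<^esub> r"
  have "foldr ?F js \<one>\<^bsub>G\<^esub> \<in> carrier G \<and> h (foldr ?F js \<one>\<^bsub>G\<^esub>) = foldr ?F' js \<one>\<^bsub>G'\<^esub>" for js :: "int list"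
    using assms(4,5) by (induction js) (auto simp: hom_int_pow int_pow_closed)
  then show ?thesis by (simp add: laurent_pow_def)
qed

lemma cycle_of_list_upt:
  assumes "i < m"
  shows "cycle_of_list [0..<m] i = (i + 1) mod m"
proof -
  \<comment> \<open>One application of the cycle rotates the list by one place; comparing the
    entries at \<open>i\<close> gives the value, wrap-around included.\<close>
  have "map (cycle_of_list [0..<m] ^^ 1) [0..<m] = rotate 1 [0..<m]"
    by (rule cyclic_rotation) simp
  then have "map (cycle_of_list [0..<m]) [0..<m] ! i = rotate 1 [0..<m] ! i"
    by (simp only: One_nat_def funpow.simps comp_id)
  also have "\<dots> = [0..<m] ! ((1 + i) mod m)"
    using assms by (subst nth_rotate) auto
  finally show ?thesis using assms by simp
qed

lemma tree_node_cong:
  assumes "\<And>i. i < m \<Longrightarrow> c i = c' i" "\<And>i. i < m \<Longrightarrow> \<sigma> i = \<sigma>' i"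
  shows "tree_node m c \<sigma> = tree_node m c' \<sigma>'"
  using assms by (auto simp: tree_node_def fun_eq_iff split: list.splits)

section \<open>Moments of finitely supported functions\<close>

text \<open>
  A Laurent polynomial \<open>v\<close> is determined modulo \<open>(x - 1)\<^sup>2\<close> by its moments with respect to the weights
  \<open>1\<close> and \<open>j\<close>, that is by \<open>v(1)\<close> and \<open>v'(1)\<close>.
\<close>

definition moment :: "(int \<Rightarrow> int) \<Rightarrow> (int \<Rightarrow> int) \<Rightarrow> int"
  where "moment g v = (\<Sum>j | v j \<noteq> 0. g j * v j)"

lemma moment_eq_sum: "finite T \<Longrightarrow> {j. v j \<noteq> 0} \<subseteq> T \<Longrightarrow> moment g v = (\<Sum>j\<in>T. g j * v j)"
  unfolding moment_def by (rule sum.mono_neutral_left) auto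

lemma moment_zero [simp]: "moment g (\<lambda>_. 0) = 0"
  by (simp add: moment_def)

lemma moment_add:
  assumes "finite {j. v j \<noteq> 0}" "finite {j. w j \<noteq> 0}"
  shows "moment g (\<lambda>j. v j + w j) = moment g v + moment g w"
proof -
  let ?T = "{j. v j \<noteq> 0} \<union> {j. w j \<noteq> 0}"
  have "finite ?T" using assms by simp
  then show ?thesis
    by (subst (1 2 3) moment_eq_sum[of ?T]) (auto simp: sum.distrib ring_distribs)
qed

lemma moment_scale: "moment g (\<lambda>j. c * v j) = c * moment g v"
proof (cases "c = 0")
  case False
  then show ?thesis by (simp add: moment_def sum_distrib_left mult_ac)
qed simp

lemma moment_mod_cong:
  assumes "finite {j. v j \<noteq> 0}"
  shows "[moment g (\<lambda>j. v j mod m) = moment g v] (mod m)"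
proof -
  \<comment> \<open>Reduction can only shrink the support, so both moments are sums over the support
    of \<open>v\<close>.\<close>
  have "{j. v j mod m \<noteq> 0} \<subseteq> {j. v j \<noteq> 0}" by auto
  then show ?thesis
    using assms
    by (subst (1 2) moment_eq_sum[of "{j. v j \<noteq> 0}"])
       (auto intro!: cong_sum cong_scalar_left cong_mod_left)
qed

text \<open>The shift moves to the weight: a constant weight is blind to it, and the weight
  \<open>j\<close> changes by a multiple of the augmentation.\<close>

lemma moment_shift: "moment g (\<lambda>j. v (j + m)) = moment (\<lambda>j. g (j - m)) v"
  unfolding moment_def
  by (rule sum.reindex_bij_witness[of _ "\<lambda>j. j - m" "\<lambda>j. j + m"]) auto

lemma moment_of_bool [simp]: "moment g (\<lambda>i. of_bool (i = j)) = g j"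
  by (simp add: moment_def)

lemma moment_affine:
  "moment (\<lambda>j. g j + c * h j) v = moment g v + c * moment h v"
  by (simp add: moment_def sum.distrib sum_distrib_left ring_distribs mult_ac)

section \<open>The lamplighter group\<close>

locale lamplighter =
  fixes p :: nat
  assumes p_prime: "Factorial_Ring.prime p"
begin

abbreviation L :: "((int \<Rightarrow> int) \<times> int) monoid"
  where "L \<equiv> lamp p"

definition base :: "(int \<Rightarrow> int) set"
  where "base = {v. (\<forall>j. 0 \<le> v j \<and> v j < int p) \<and> finite {j. v j \<noteq> 0}}"

definition reduce :: "(int \<Rightarrow> int) \<Rightarrow> int \<Rightarrow> int"
  where "reduce v = (\<lambda>j. v j mod int p)"

abbreviation aug :: "(int \<Rightarrow> int) \<Rightarrow> int"
  where "aug \<equiv> moment (\<lambda>_. 1)"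

text \<open>The Laurent polynomial \<open>(x - 1) x^j\<close>; \<open>reduce\<close> represents the
  coefficient -1 by \<open>p - 1\<close>.\<close>

definition dif :: "int \<Rightarrow> int \<Rightarrow> int"
  where "dif j = reduce (\<lambda>i. of_bool (i = j + 1) - of_bool (i = j))"

text \<open>Over GF(p) this is the principal ideal \<open>(x - 1) A\<close>, since divisibility by
  \<open>x - 1\<close> means vanishing at 1.\<close>

definition aug_ideal :: "(int \<Rightarrow> int) set"
  where "aug_ideal = {v \<in> base. [aug v = 0] (mod int p)}"

lemma p_gt_1: "1 < p"
  using p_prime by (rule prime_gt_1_nat)

sublocale L: group L
  by (rule lamp_group)

section \<open>Finite supports and reduction modulo \<open>p\<close>\<close>

lemma base_finite: "v \<in> base \<Longrightarrow> finite {j. v j \<noteq> 0}"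
  by (simp add: base_def)

lemma finite_support_shift: "finite {j. v j \<noteq> (0::int)} \<Longrightarrow> finite {j. v (j + m :: int) \<noteq> 0}"
  by (drule finite_vimageI[of _ "\<lambda>j. j + m"]) (auto simp: vimage_def inj_on_def)

lemma finite_support_add:
  assumes "finite {j. v j \<noteq> (0::int)}" "finite {j. w j \<noteq> 0}"
  shows "finite {j. v j + w j \<noteq> 0}"
proof -
  have "{j. v j + w j \<noteq> 0} \<subseteq> {j. v j \<noteq> 0} \<union> {j. w j \<noteq> 0}" by auto
  then show ?thesis using assms by (metis finite_UnI finite_subset)
qed

lemma finite_support_diff:
  assumes "finite {j. v j \<noteq> (0::int)}" "finite {j. w j \<noteq> 0}"
  shows "finite {j. v j - w j \<noteq> 0}"
proof -
  have "{j. v j - w j \<noteq> 0} \<subseteq> {j. v j \<noteq> 0} \<union> {j. w j \<noteq> 0}" by auto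
  then show ?thesis using assms by (metis finite_UnI finite_subset)
qed

lemma finite_support_scale: "finite {j. v j \<noteq> (0::int)} \<Longrightarrow> finite {j. c * v j \<noteq> 0}"
  by (rule finite_subset[of _ "{j. v j \<noteq> 0}"]) auto

lemma finite_support_minus: "finite {j. v j \<noteq> (0::int)} \<Longrightarrow> finite {j. - v j \<noteq> 0}"
  by simp

lemma finite_support_of_bool: "finite {i. (of_bool (i = j) :: int) \<noteq> 0}"
  by simp

lemmas finite_support = base_finite finite_support_shift finite_support_add finite_support_diff
  finite_support_scale finite_support_minus finite_support_of_bool

lemma reduce_base: "finite {j. v j \<noteq> 0} \<Longrightarrow> reduce v \<in> base"
  using p_gt_1 by (auto simp: base_def reduce_def elim!: rev_finite_subset)

lemma reduce_eq: "v \<in> base \<Longrightarrow> reduce v = v"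
  by (auto simp: base_def reduce_def)

lemma base_zero [simp]: "(\<lambda>_. 0) \<in> base"
  using p_gt_1 by (simp add: base_def)

lemma base_of_bool [simp]: "(\<lambda>i. of_bool (i = j)) \<in> base"
  using p_gt_1 by (auto simp: base_def)

lemma base_shift: "v \<in> base \<Longrightarrow> (\<lambda>j. v (j + m)) \<in> base"
  using finite_support_shift by (auto simp: base_def)

lemma moment_reduce: "finite {j. v j \<noteq> 0} \<Longrightarrow> [moment g (reduce v) = moment g v] (mod int p)"
  unfolding reduce_def by (rule moment_mod_cong)

lemma moment_reduce_add:
  assumes "v \<in> base" "w \<in> base"
  shows "[moment g (reduce (\<lambda>j. v j + w j)) = moment g v + moment g w] (mod int p)"
  using moment_reduce[OF finite_support_add[OF assms[THEN base_finite]], of g]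
    moment_add[OF assms[THEN base_finite], of g] by (simp only:)

lemma moment_reduce_diff:
  assumes "v \<in> base" "w \<in> base"
  shows "[moment g (reduce (\<lambda>j. v j - w j)) = moment g v - moment g w] (mod int p)"
proof -
  have "moment g (\<lambda>j. v j + (-1) * w j) = moment g v + (-1) * moment g w"
    using assms[THEN base_finite] by (simp only: moment_add finite_support_scale moment_scale)
  then show ?thesis
    using moment_reduce[OF finite_support_diff[OF assms[THEN base_finite]], of g] by simp
qed

lemma moment_reduce_scale:
  assumes "v \<in> base"
  shows "[moment g (reduce (\<lambda>j. c * v j)) = c * moment g v] (mod int p)"
  using moment_reduce[OF finite_support_scale[OF base_finite[OF assms]], of g]
  by (simp only: moment_scale)

text \<open>For the constant weight the right side is 0, for the weight \<open>j\<close> it is 1.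
  The latter normalises the derivative at 1 on the generators of \<open>(x - 1) A\<close>.\<close>

lemma moment_dif: "[moment g (dif j) = g (j + 1) - g j] (mod int p)"
proof -
  have "moment g (\<lambda>i. of_bool (i = j + 1) + (-1) * of_bool (i = j)) = g (j + 1) - g j"
    by (subst moment_add) (simp_all only: finite_support moment_scale moment_of_bool)
  moreover have "[moment g (dif j) = moment g (\<lambda>i. of_bool (i = j + 1) - of_bool (i = j))] (mod int p)"
    unfolding dif_def by (intro moment_reduce finite_support)
  ultimately show ?thesis by simp
qed

lemma dif_base [simp]: "dif j \<in> base"
  unfolding dif_def by (intro reduce_base finite_support)

lemma dif_aug_ideal [simp]: "dif j \<in> aug_ideal"
  using moment_dif[of "\<lambda>_. 1" j] by (simp add: aug_ideal_def)

lemma reduce_cong: "(\<And>j. [v j = w j] (mod int p)) \<Longrightarrow> reduce v = reduce w"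
  by (auto simp: reduce_def cong_def)

section \<open>The augmentation ideal, its generators and its shift-invariant functionals\<close>

lemma aug_ideal_base: "v \<in> aug_ideal \<Longrightarrow> v \<in> base"
  by (simp add: aug_ideal_def)

lemma aug_ideal_zero [simp]: "(\<lambda>_. 0) \<in> aug_ideal"
  by (simp add: aug_ideal_def)

lemma aug_ideal_reduce:
  "finite {j. v j \<noteq> 0} \<Longrightarrow> reduce v \<in> aug_ideal \<longleftrightarrow> [aug v = 0] (mod int p)"
  using moment_reduce[of v "\<lambda>_. 1"] by (auto simp: aug_ideal_def reduce_base intro: cong_trans cong_sym)

lemma aug_ideal_add:
  assumes "v \<in> aug_ideal" "w \<in> aug_ideal"
  shows "reduce (\<lambda>j. v j + w j) \<in> aug_ideal"
  using assms cong_add[of "aug v" 0 "int p" "aug w" 0]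
  by (subst aug_ideal_reduce) (auto simp: aug_ideal_def finite_support moment_add)

lemma aug_ideal_shift: "v \<in> aug_ideal \<Longrightarrow> (\<lambda>j. v (j + m)) \<in> aug_ideal"
  by (auto simp: aug_ideal_def base_shift moment_shift)

text \<open>The elements \<open>(x - 1) x^j\<close> span the ideal additively: subtracting a
  multiple of one of them removes the top coefficient and keeps the augmentation, so the support
  shrinks to a single point, where the coefficient must be 0.\<close>

lemma aug_ideal_induct [consumes 1, case_names zero add dif]:
  assumes "v \<in> aug_ideal"
    and zero: "P (\<lambda>_. 0)"
    and add: "\<And>v w. \<lbrakk>v \<in> aug_ideal; w \<in> aug_ideal; P v; P w\<rbrakk> \<Longrightarrow> P (reduce (\<lambda>j. v j + w j))"
    and dif: "\<And>j. P (dif j)"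
  shows "P v"
proof -
  \<comment> \<open>The rule \<open>add\<close> offers only sums, so a multiple of a generator is
    built by repeated addition.\<close>
  have mult: "reduce (\<lambda>i. int m * dif j i) \<in> aug_ideal \<and> P (reduce (\<lambda>i. int m * dif j i))" for m j
  proof (induction m)
    case 0
    then show ?case using zero by (simp add: reduce_def)
  next
    case (Suc m)
    have "reduce (\<lambda>i. reduce (\<lambda>i. int m * d i) i + d i) = reduce (\<lambda>i. int (Suc m) * d i)" for d
      by (rule reduce_cong) (simp add: reduce_def cong_def algebra_simps mod_simps)
    moreover have "reduce (\<lambda>i. reduce (\<lambda>i. int m * dif j i) i + dif j i) \<in> aug_ideal"
      using Suc by (intro aug_ideal_add dif_aug_ideal) simp
    moreover have "P (reduce (\<lambda>i. reduce (\<lambda>i. int m * dif j i) i + dif j i))"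
      using Suc dif by (intro add dif_aug_ideal) simp_all
    ultimately show ?case by (simp only:)
  qed
  have "P v" if "v \<in> aug_ideal" "{j. v j \<noteq> 0} \<subseteq> {l..l + int N}" for v l N
    using that
  proof (induction N arbitrary: v)
    case 0
    then have v: "v j = 0" if "j \<noteq> l" for j using that by auto
    have "aug v = v l"
      by (subst moment_eq_sum[of "{l}"]) (use v in auto)
    then have "v l mod int p = 0"
      using 0(1) by (simp add: aug_ideal_def cong_def)
    then have "v l = 0"
      using aug_ideal_base[OF 0(1)] by (simp add: base_def)
    then have "v = (\<lambda>_. 0)" using v by (metis ext)
    then show ?case using zero by simp
  next
    case (Suc N)
    \<comment> \<open>The support ends at \<open>t + 1\<close>. As \<open>dif t\<close> has
      coefficient 1 there and its other nonzero coefficient at \<open>t\<close>, subtracting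
      \<open>m\<close> copies pushes the top coefficient down by one place.\<close>
    define t where "t = l + int N"
    define m where "m = nat (v (t + 1))"
    have m: "int m = v (t + 1)" using Suc(2) by (simp add: m_def aug_ideal_def base_def)
    define w where "w = reduce (\<lambda>j. v j - int m * dif t j)"
    have vb: "v \<in> base" using Suc(2) by (rule aug_ideal_base)
    have supp: "finite {j. v j \<noteq> 0}" "finite {j. int m * dif t j \<noteq> 0}"
      by (intro finite_support vb dif_base)+
    have "moment (\<lambda>_. 1) (\<lambda>j. v j + (- 1) * (int m * dif t j)) = aug v - int m * aug (dif t)"
      by (subst moment_add) (simp_all only: finite_support supp moment_scale)
    moreover have "[aug v - int m * aug (dif t) = 0 - int m * 0] (mod int p)"
      using Suc(2) dif_aug_ideal[of t] by (intro cong_diff cong_mult) (auto simp: aug_ideal_def)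
    ultimately have w: "w \<in> aug_ideal"
      unfolding w_def by (subst aug_ideal_reduce[OF finite_support_diff[OF supp]]) simp
    have "w j = 0" if "j \<notin> {l..l + int N}" for j
    proof (cases "j = t + 1")
      case True
      then show ?thesis using m p_gt_1 by (simp add: w_def reduce_def dif_def)
    next
      case False
      then have "v j = 0" "dif t j = 0"
        using that Suc(3) by (auto simp: t_def reduce_def dif_def)
      then show ?thesis by (simp add: w_def reduce_def)
    qed
    then have "P w" using w by (intro Suc.IH) auto
    then have "P (reduce (\<lambda>j. w j + reduce (\<lambda>i. int m * dif t i) j))"
      using w mult by (intro add) auto
    moreover have "reduce (\<lambda>j. reduce (\<lambda>j. v j - int m * d j) j + reduce (\<lambda>i. int m * d i) j) = reduce v" for d
      by (rule reduce_cong) (simp add: reduce_def cong_def mod_simps)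
    then have "reduce (\<lambda>j. w j + reduce (\<lambda>i. int m * dif t i) j) = v"
      by (simp only: w_def reduce_eq[OF vb])
    ultimately show ?case by (simp only:)
  qed
  moreover have "finite {j. v j \<noteq> 0}"
    using assms(1) by (intro base_finite aug_ideal_base)
  then obtain a b :: int where "{j. v j \<noteq> 0} \<subseteq> {a..b}"
    by (meson bdd_above_def bdd_below_def bdd_above_finite bdd_below_finite atLeastAtMost_iff subsetI)
  then have "{j. v j \<noteq> 0} \<subseteq> {a..a + int (nat (b - a))}" by auto
  ultimately show ?thesis using assms(1) by blast
qed

text \<open>Such a functional takes one value on all generators, because they are shifts of each
  other. The derivative at 1 is 1 on each of them, and additivity propagates the comparison. In
  other words, \<open>F\<close> factors through \<open>(x - 1) A\<close> modulo
  \<open>(x - 1)^2 A\<close>, which has dimension one.\<close>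

lemma shift_invariant_on_aug_ideal:
  assumes add: "\<And>v w. \<lbrakk>v \<in> aug_ideal; w \<in> aug_ideal\<rbrakk>
      \<Longrightarrow> [F (reduce (\<lambda>j. v j + w j)) = F v + F w] (mod int p)"
    and shift: "\<And>v. v \<in> aug_ideal \<Longrightarrow> [F (\<lambda>j. v (j + 1)) = F v] (mod int p)"
    and v: "v \<in> aug_ideal"
  shows "[F v = F (dif 0) * moment (\<lambda>j. j) v] (mod int p)"
  using v
proof (induction v rule: aug_ideal_induct)
  case zero
  have "[F (\<lambda>_. 0) = F (\<lambda>_. 0) + F (\<lambda>_. 0)] (mod int p)"
    using add[of "\<lambda>_. 0" "\<lambda>_. 0"] by (simp add: reduce_def)
  then have "[F (\<lambda>_. 0) = 0] (mod int p)"
    by (simp add: cong_iff_dvd_diff)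
  then show ?case by simp
next
  case (add v w)
  have "[moment (\<lambda>j. j) (reduce (\<lambda>j. v j + w j)) = moment (\<lambda>j. j) v + moment (\<lambda>j. j) w] (mod int p)"
    using add(1,2) by (intro moment_reduce_add aug_ideal_base)
  then have "[F (dif 0) * moment (\<lambda>j. j) (reduce (\<lambda>j. v j + w j)) =
      F (dif 0) * moment (\<lambda>j. j) v + F (dif 0) * moment (\<lambda>j. j) w] (mod int p)"
    unfolding distrib_left[symmetric] by (rule cong_scalar_left)
  moreover have "[F v + F w = F (dif 0) * moment (\<lambda>j. j) v + F (dif 0) * moment (\<lambda>j. j) w] (mod int p)"
    using add by (intro cong_add)
  ultimately show ?case
    using assms(1)[OF add(1,2)] by (meson cong_trans cong_sym)
next
  case (dif j)
  have step: "[F (dif j) = F (dif (j + 1))] (mod int p)" for j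
  proof -
    \<comment> \<open>Adding 1 to the argument lowers every exponent by one.\<close>
    have "(\<lambda>i. dif (j + 1) (i + 1)) = dif j"
      by (rule ext) (auto simp: reduce_def dif_def)
    then show ?thesis using shift[OF dif_aug_ideal[of "j + 1"]] by (simp only:)
  qed
  have "[F (dif j) = F (dif 0)] (mod int p)"
  proof (induction j rule: int_induct[of _ 0])
    case (step1 i)
    then show ?case using step[of i] by (meson cong_trans cong_sym)
  next
    case (step2 i)
    then show ?case using step[of "i - 1"] by (auto intro: cong_trans)
  qed simp
  moreover have "[F (dif 0) * moment (\<lambda>j. j) (dif j) = F (dif 0) * 1] (mod int p)"
    using moment_dif[of "\<lambda>j. j" j] by (intro cong_scalar_left) simp
  ultimately show ?case by (simp only: mult_1_right) (meson cong_sym cong_trans)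
qed

section \<open>The lamplighter group in coordinates\<close>

lemma base_eq: "base = carrier (wreath_base (integer_mod_group p) integer_group)"
  using p_gt_1 by (auto simp: base_def carrier_wreath_base carrier_integer_mod_group)

lemma carrier_L [simp]: "carrier L = base \<times> UNIV"
  by (simp add: carrier_lamp base_eq)

lemma L_mult [simp]: "(s, m) \<otimes>\<^bsub>L\<^esub> (t, n) = (reduce (\<lambda>j. s j + t (j + m)), m + n)"
  by (simp add: lamp_mult reduce_def)

lemma L_mult_base [simp]: "(s, 0) \<otimes>\<^bsub>L\<^esub> (t, n) = (reduce (\<lambda>j. s j + t j), n)"
  by simp

lemma L_one [simp]: "\<one>\<^bsub>L\<^esub> = ((\<lambda>_. 0), 0)"
  by (simp add: lamp_def rwreath_def wreath_base_def restrict_def)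

lemma lamp_A_eq: "lamp_A p = base \<times> {0}"
  by (simp add: lamp_A_def base_eq)

lemma lamp_X_eq': "lamp_X p = {\<lambda>_. 0} \<times> UNIV"
  using p_gt_1 by (rule lamp_X_eq)

lemma lamp_a_eq: "lamp_a = ((\<lambda>i. of_bool (i = 0)), 0)"
  by (auto simp: lamp_a_def)

lemma L_inv:
  assumes "v \<in> base"
  shows "inv\<^bsub>L\<^esub> (v, m) = (reduce (\<lambda>j. - v (j - m)), - m)"
proof (rule L.inv_equality)
  have "reduce (\<lambda>j. reduce (\<lambda>j. - v (j - m)) j + v (j + - m)) = (\<lambda>_. 0)"
    by (simp add: reduce_def mod_simps)
  then show "(reduce (\<lambda>j. - v (j - m)), - m) \<otimes>\<^bsub>L\<^esub> (v, m) = \<one>\<^bsub>L\<^esub>" by simp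
  show "(reduce (\<lambda>j. - v (j - m)), - m) \<in> carrier L"
    using finite_support_shift[OF base_finite[OF assms], of "- m"] by (auto intro!: reduce_base)
qed (use assms in auto)

text \<open>The right side is a homomorphism in \<open>c\<close> from the integers, hence determined
  by its value at the generator 1.\<close>

lemma base_pow:
  assumes "v \<in> base"
  shows "(v, 0) [^]\<^bsub>L\<^esub> (c :: int) = (reduce (\<lambda>j. c * v j), 0)"
proof -
  have "reduce (\<lambda>j. c * v j) \<in> base" for c
    by (intro reduce_base finite_support assms)
  moreover have "reduce (\<lambda>j. (c + d) * v j) = reduce (\<lambda>j. reduce (\<lambda>j. c * v j) j + reduce (\<lambda>j. d * v j) j)" for c d
    by (simp add: reduce_def mod_simps ring_distribs)
  ultimately have "(\<lambda>c. (reduce (\<lambda>j. c * v j), 0)) \<in> hom integer_group L"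
    by (intro homI) simp_all
  then have "(reduce (\<lambda>j. (1 [^]\<^bsub>integer_group\<^esub> c) * v j), 0) = (reduce (\<lambda>j. 1 * v j), 0) [^]\<^bsub>L\<^esub> c"
    by (rule hom_int_pow) (simp_all add: L.is_group)
  then show ?thesis using assms by (simp add: reduce_eq)
qed

text \<open>The conjugate of \<open>a\<close> by \<open>x^j\<close> is the monomial at
  \<open>j\<close>, so the product assembles \<open>u\<close> coefficient by coefficient. This
  identifies \<open>a^u\<close> with \<open>u\<close> itself.\<close>

lemma laurent_pow_lamp:
  assumes "u \<in> base"
  shows "laurent_pow L lamp_a lamp_x u = (u, 0)"
proof -
  let ?F = "\<lambda>j r. (lamp_x [^]\<^bsub>L\<^esub> (- j) \<otimes>\<^bsub>L\<^esub> lamp_a \<otimes>\<^bsub>L\<^esub> lamp_x [^]\<^bsub>L\<^esub> j) [^]\<^bsub>L\<^esub> u j \<otimes>\<^bsub>L\<^esub> r"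
  have conj: "lamp_x [^]\<^bsub>L\<^esub> (- j) \<otimes>\<^bsub>L\<^esub> lamp_a \<otimes>\<^bsub>L\<^esub> lamp_x [^]\<^bsub>L\<^esub> j = ((\<lambda>i. of_bool (i = j)), 0)" for j
    unfolding lamp_conj[OF p_gt_1] by (simp add: of_bool_def)
  \<comment> \<open>For an arbitrary list of distinct indices the partial product is the restriction
    of \<open>u\<close> to that list.\<close>
  have "foldr ?F js \<one>\<^bsub>L\<^esub> = ((\<lambda>i. if i \<in> set js then u i else 0), 0)" if "distinct js" for js
    using that
  proof (induction js)
    case (Cons j js)
    have "reduce (\<lambda>i. reduce (\<lambda>i. u j * of_bool (i = j)) i + (if i \<in> set js then u i else 0)) =
        (\<lambda>i. if i \<in> set (j # js) then u i else 0)"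
      using Cons.prems assms by (auto simp: reduce_def base_def fun_eq_iff)
    then show ?case
      using Cons assms by (simp add: conj base_pow del: L_mult)
  qed simp
  from this[of "sorted_list_of_set {j. u j \<noteq> 0}"] show ?thesis
    using base_finite[OF assms] by (auto simp: laurent_pow_def fun_eq_iff)
qed

lemma laurent_residue_ring: "u \<in> base \<Longrightarrow> u \<in> laurent (residue_ring (int p))"
  by (auto simp: laurent_def base_def residue_ring_def)

lemma laurent_at_one_residue_ring:
  assumes "u \<in> base"
  shows "laurent_at_one (residue_ring (int p)) u = aug u mod int p"
proof -
  interpret residues "int p" "residue_ring (int p)"
    using p_gt_1 by unfold_locales simp_all
  have "finsum (residue_ring (int p)) u T = (\<Sum>j\<in>T. u j) mod int p" if "finite T" for T
    using that
  proof (induction T)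
    case (insert j T)
    then show ?case
      using assms
      by (subst finsum_insert) (auto simp: base_def res_carrier_eq res_add_eq mod_simps)
  qed (simp add: res_zero_eq)
  then show ?thesis
    using base_finite[OF assms] by (simp add: laurent_at_one_def res_zero_eq moment_def)
qed

section \<open>The representation of a split pair\<close>

definition aug_hom :: "(int \<Rightarrow> int) \<times> int \<Rightarrow> int"
  where "aug_hom g = aug (fst g) mod int p"

text \<open>This is the power \<open>a^i\<close>; for \<open>i < p\<close> the coefficient is
  already reduced.\<close>

definition rep :: "nat \<Rightarrow> (int \<Rightarrow> int) \<times> int"
  where "rep i = ((\<lambda>j. int i * of_bool (j = 0)), 0)"

lemma rep_carrier: "i < p \<Longrightarrow> rep i \<in> carrier L"
  by (auto simp: rep_def base_def)

lemma aug_hom_rep: "i < p \<Longrightarrow> aug_hom (rep i) = int i"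
  by (simp add: aug_hom_def rep_def moment_scale)

lemma aug_hom_hom: "group_hom L (integer_mod_group p) aug_hom"
proof -
  have "aug_hom \<in> hom L (integer_mod_group p)"
  proof (rule homI)
    fix g h assume gh: "g \<in> carrier L" "h \<in> carrier L"
    obtain s m t n where [simp]: "g = (s, m)" "h = (t, n)" by (metis surj_pair)
    have "[aug (reduce (\<lambda>j. s j + t (j + m))) = aug s + aug (\<lambda>j. t (j + m))] (mod int p)"
      using gh by (intro moment_reduce_add base_shift) auto
    then show "aug_hom (g \<otimes>\<^bsub>L\<^esub> h) = aug_hom g \<otimes>\<^bsub>integer_mod_group p\<^esub> aug_hom h"
      by (simp add: aug_hom_def moment_shift cong_def mod_simps)
  qed (use p_gt_1 in \<open>auto simp: aug_hom_def carrier_integer_mod_group\<close>)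
  then show ?thesis
    by (simp add: group_hom_def group_hom_axioms_def L.is_group)
qed

text \<open>This is the subgroup \<open>(x - 1) A X\<close>, the domain of the split pair.\<close>

definition ker :: "((int \<Rightarrow> int) \<times> int) set"
  where "ker = aug_ideal \<times> UNIV"

lemma ker_eq: "ker = kernel L (integer_mod_group p) aug_hom"
  by (auto simp: ker_def kernel_def aug_ideal_def aug_hom_def cong_def)

lemma ker_subgroup: "subgroup ker L"
  unfolding ker_eq by (rule group_hom.subgroup_kernel[OF aug_hom_hom])

lemma ker_coset_eq_iff:
  "g \<in> carrier L \<Longrightarrow> h \<in> carrier L \<Longrightarrow> ker #>\<^bsub>L\<^esub> g = ker #>\<^bsub>L\<^esub> h \<longleftrightarrow> aug_hom g = aug_hom h"
  unfolding ker_eq by (rule group_hom.kernel_rcos_eq_iff[OF aug_hom_hom])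

lemma ker_coset_eq_rep:
  assumes "g \<in> carrier L"
  shows "nat (aug_hom g) < p" "ker #>\<^bsub>L\<^esub> g = ker #>\<^bsub>L\<^esub> rep (nat (aug_hom g))"
proof -
  have "0 \<le> aug_hom g" "aug_hom g < int p"
    using p_gt_1 by (auto simp: aug_hom_def)
  then show 1: "nat (aug_hom g) < p" by simp
  show "ker #>\<^bsub>L\<^esub> g = ker #>\<^bsub>L\<^esub> rep (nat (aug_hom g))"
    using assms rep_carrier[OF 1] aug_hom_rep[OF 1] \<open>0 \<le> aug_hom g\<close>
    by (subst ker_coset_eq_iff) auto
qed

text \<open>The cosets of \<open>ker\<close> are the fibres of \<open>aug_hom\<close>, and
  \<open>rep 0\<close>, ..., \<open>rep (p - 1)\<close> take each of its values exactly
  once.\<close>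

lemma ker_transversal: "right_transversal L p ker rep"
proof -
  have "inj_on (\<lambda>i. ker #>\<^bsub>L\<^esub> rep i) {..<p}"
  proof (rule inj_onI)
    fix i j assume ij: "i \<in> {..<p}" "j \<in> {..<p}" and "ker #>\<^bsub>L\<^esub> rep i = ker #>\<^bsub>L\<^esub> rep j"
    then have "aug_hom (rep i) = aug_hom (rep j)"
      by (subst (asm) ker_coset_eq_iff) (auto intro!: rep_carrier simp del: carrier_L)
    then show "i = j" using ij by (simp add: aug_hom_rep)
  qed
  moreover have "(\<lambda>i. ker #>\<^bsub>L\<^esub> rep i) ` {..<p} = rcosets\<^bsub>L\<^esub> ker"
  proof
    show "(\<lambda>i. ker #>\<^bsub>L\<^esub> rep i) ` {..<p} \<subseteq> rcosets\<^bsub>L\<^esub> ker"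
      using rep_carrier by (auto simp: RCOSETS_def simp del: carrier_L)
    show "rcosets\<^bsub>L\<^esub> ker \<subseteq> (\<lambda>i. ker #>\<^bsub>L\<^esub> rep i) ` {..<p}"
    proof
      fix C assume "C \<in> rcosets\<^bsub>L\<^esub> ker"
      then obtain g where "g \<in> carrier L" "C = ker #>\<^bsub>L\<^esub> g"
        unfolding RCOSETS_def by blast
      with ker_coset_eq_rep[OF this(1)] show "C \<in> (\<lambda>i. ker #>\<^bsub>L\<^esub> rep i) ` {..<p}" by blast
    qed
  qed
  ultimately show ?thesis
    using rep_carrier unfolding right_transversal_def bij_betw_def by blast
qed

lemma ker_similarity_pair:
  assumes "fd \<in> hom (L\<lparr>carrier := ker\<rparr>) L"
  shows "similarity_pair L p ker fd"
proof -
  have "bij_betw (\<lambda>i. ker #>\<^bsub>L\<^esub> rep i) {..<p} (rcosets\<^bsub>L\<^esub> ker)"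
    using ker_transversal by (simp add: right_transversal_def)
  then have "finite (rcosets\<^bsub>L\<^esub> ker)" "card (rcosets\<^bsub>L\<^esub> ker) = p"
    using bij_betw_finite bij_betw_same_card by fastforce+
  then show ?thesis
    using assms ker_subgroup by (simp add: similarity_pair_def)
qed

text \<open>As cosets are labelled by \<open>aug_hom\<close>, the element \<open>g\<close> adds its
  own label: \<open>a\<close> acts as the cycle and \<open>x\<close> trivially.\<close>

lemma ker_coset_perm:
  assumes "g \<in> carrier L" "i < p"
  shows "coset_perm L p ker rep g i = nat ((int i + aug_hom g) mod int p)"
proof -
  interpret group_hom L "integer_mod_group p" aug_hom by (rule aug_hom_hom)
  have "ker #>\<^bsub>L\<^esub> (rep i \<otimes>\<^bsub>L\<^esub> g) = ker #>\<^bsub>L\<^esub> rep j \<longleftrightarrow> j = nat ((int i + aug_hom g) mod int p)"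
    if "j < p" for j
    using that assms rep_carrier[of i] rep_carrier[of j] p_gt_1
    by (subst ker_coset_eq_iff) (auto simp: aug_hom_rep simp del: carrier_L)
  moreover have "nat ((int i + aug_hom g) mod int p) < p"
    using p_gt_1 by (simp add: nat_less_iff)
  ultimately show ?thesis
    using assms(2) by (auto simp: coset_perm_def intro!: the_equality)
qed

section \<open>Permutations and cocycles of \<open>a\<close> and \<open>x\<close>\<close>

lemma lamp_a_carrier: "lamp_a \<in> carrier L"
  by (simp add: lamp_a_eq)

lemma lamp_x_carrier: "lamp_x \<in> carrier L"
  by (simp add: lamp_x_def)

lemma aug_hom_lamp_a: "aug_hom lamp_a = 1"
  using p_gt_1 by (simp add: aug_hom_def lamp_a_eq)

lemma aug_hom_lamp_x: "aug_hom lamp_x = 0"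
  by (simp add: aug_hom_def lamp_x_def)

lemma rep_mult_a:
  assumes "i < p"
  shows "rep i \<otimes>\<^bsub>L\<^esub> lamp_a = rep ((i + 1) mod p)"
  by (auto simp: rep_def lamp_a_eq reduce_def fun_eq_iff of_nat_mod add.commute)

lemma ker_coset_perm_a:
  assumes "i < p"
  shows "coset_perm L p ker rep lamp_a i = (i + 1) mod p"
proof -
  have "coset_perm L p ker rep lamp_a i = nat (int (i + 1) mod int p)"
    using ker_coset_perm[OF lamp_a_carrier assms] by (simp only: aug_hom_lamp_a of_nat_add of_nat_1)
  then show ?thesis by (simp only: of_nat_mod[symmetric] nat_int)
qed

text \<open>Multiplying a representative by \<open>a\<close> gives a representative again, also at
  \<open>i = p - 1\<close> because \<open>a^p = 1\<close>. Hence all states of \<open>a\<close> are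
  trivial.\<close>

lemma ker_coset_cocycle_a:
  assumes "i < p"
  shows "coset_cocycle L p ker rep lamp_a i = \<one>\<^bsub>L\<^esub>"
proof -
  have "(i + 1) mod p < p" using p_gt_1 by simp
  then show ?thesis
    unfolding coset_cocycle_def ker_coset_perm_a[OF assms] rep_mult_a[OF assms]
    by (intro L.r_inv rep_carrier)
qed

text \<open>Moving \<open>x\<close> to the left conjugates \<open>a^i\<close> into the Laurent
  polynomial \<open>i x\<close>, which splits as \<open>i (x - 1) + i\<close>.\<close>

lemma rep_mult_x:
  assumes "i < p"
  shows "rep i \<otimes>\<^bsub>L\<^esub> lamp_x = lamp_x \<otimes>\<^bsub>L\<^esub> (dif 0, 0) [^]\<^bsub>L\<^esub> i \<otimes>\<^bsub>L\<^esub> rep i"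
proof -
  have "(dif 0, 0) [^]\<^bsub>L\<^esub> i = (reduce (\<lambda>j. int i * dif 0 j), 0)"
    using base_pow[OF dif_base, of 0 "int i"] by (simp add: int_pow_int)
  moreover have red: "reduce (\<lambda>j. reduce (\<lambda>j. reduce (\<lambda>j. int i * d j) (j + 1)) j + e (j + 1)) = 
      reduce (\<lambda>j. int i * d (j + 1) + e (j + 1))" for d e
    by (simp add: reduce_def mod_simps)
  moreover have "reduce (\<lambda>j. int i * dif 0 (j + 1) + int i * of_bool (j + 1 = 0)) =
      reduce (\<lambda>j. int i * of_bool (j = 0))"
  proof (rule reduce_cong)
    fix j :: int
    have "[dif 0 (j + 1) = of_bool (j = 0) - of_bool (j + 1 = 0)] (mod int p)"
      by (simp add: reduce_def dif_def)
    then have "[int i * dif 0 (j + 1) + int i * of_bool (j + 1 = 0) =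
       int i * (of_bool (j = 0) - of_bool (j + 1 = 0)) + int i * of_bool (j + 1 = 0)] (mod int p)"
      by (intro cong_add cong_scalar_left cong_refl)
    then show "[int i * dif 0 (j + 1) + int i * of_bool (j + 1 = 0) = int i * of_bool (j = 0)] (mod int p)"
      by (simp add: ring_distribs)
  qed
  ultimately show ?thesis
    using red[of "dif 0" "\<lambda>j. int i * of_bool (j = 0)"] by (simp add: rep_def lamp_x_def)
qed

lemma ker_coset_cocycle_x:
  assumes "i < p"
  shows "coset_cocycle L p ker rep lamp_x i = lamp_x \<otimes>\<^bsub>L\<^esub> (dif 0, 0) [^]\<^bsub>L\<^esub> i"
proof -
  have "coset_perm L p ker rep lamp_x i = i"
    using assms by (simp add: ker_coset_perm lamp_x_carrier aug_hom_lamp_x del: carrier_L)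
  moreover have "lamp_x \<otimes>\<^bsub>L\<^esub> (dif 0, 0) [^]\<^bsub>L\<^esub> i \<in> carrier L"
    by (intro L.m_closed L.nat_pow_closed lamp_x_carrier) simp
  ultimately show ?thesis
    unfolding coset_cocycle_def rep_mult_x[OF assms] using rep_carrier[OF assms]
    by (simp only: L.m_assoc L.r_inv L.r_one L.inv_closed)
qed

text \<open>The state of \<open>x\<close> at \<open>i\<close> is the image of
  \<open>x (a^(x - 1))^i\<close>, so the two given values of \<open>fd\<close> determine it as
  \<open>x^n (a^u)^i\<close>. Since the representation is a homomorphism, this turns into an
  expression in the images of \<open>a\<close> and \<open>x\<close>.\<close>

lemma ker_rep_recursion:
  assumes fd: "fd \<in> hom (L\<lparr>carrier := ker\<rparr>) L"
    and u: "fd (dif 0, 0) = (u, 0)" and n: "fd lamp_x = ((\<lambda>_. 0), n)"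
  defines "\<phi> \<equiv> sc_rep L p ker fd rep"
  shows "\<phi> lamp_a = rooted_cycle p"
    and "\<phi> lamp_x = tree_node p (\<lambda>i. \<phi> lamp_x [^]\<^bsub>tree_aut p\<^esub> n \<otimes>\<^bsub>tree_aut p\<^esub>
           laurent_pow (tree_aut p) (\<phi> lamp_a) (\<phi> lamp_x) u [^]\<^bsub>tree_aut p\<^esub> i) id"
proof -
  interpret T: group "tree_aut p" by (rule tree_aut_group)
  have hom: "\<phi> \<in> hom L (tree_aut p)"
    unfolding \<phi>_def by (rule sc_rep_hom[OF L.is_group ker_similarity_pair[OF fd] ker_transversal])
  interpret \<phi>: group_hom L "tree_aut p" \<phi>
    by (simp add: group_hom_def group_hom_axioms_def hom L.is_group T.is_group)
  interpret K: group "L\<lparr>carrier := ker\<rparr>"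
    by (rule L.subgroup_imp_group[OF ker_subgroup])
  interpret fd: group_hom "L\<lparr>carrier := ker\<rparr>" L fd
    by (simp add: group_hom_def group_hom_axioms_def fd L.is_group K.is_group)
  have rec: "\<phi> g = tree_node p (\<lambda>i. \<phi> (fd (coset_cocycle L p ker rep g i))) (coset_perm L p ker rep g)" for g
    unfolding \<phi>_def by (rule sc_rep_rec)
  have dif_ker: "(dif 0, 0) \<in> ker" and x_ker: "lamp_x \<in> ker"
    by (auto simp: ker_def lamp_x_def)
  have "u \<in> base"
    using fd.hom_closed[of "(dif 0, 0)"] dif_ker u by simp
  show "\<phi> lamp_a = rooted_cycle p"
    unfolding rooted_cycle_def
  proof (subst rec, rule tree_node_cong)
    fix i assume "i < p"
    then show "\<phi> (fd (coset_cocycle L p ker rep lamp_a i)) = \<one>\<^bsub>tree_aut p\<^esub>"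
      using fd.hom_one \<phi>.hom_one by (simp add: ker_coset_cocycle_a del: L_one)
    show "coset_perm L p ker rep lamp_a i = cycle_of_list [0..<p] i"
      using \<open>i < p\<close> by (simp only: cycle_of_list_upt ker_coset_perm_a)
  qed
  show "\<phi> lamp_x = tree_node p (\<lambda>i. \<phi> lamp_x [^]\<^bsub>tree_aut p\<^esub> n \<otimes>\<^bsub>tree_aut p\<^esub>
           laurent_pow (tree_aut p) (\<phi> lamp_a) (\<phi> lamp_x) u [^]\<^bsub>tree_aut p\<^esub> i) id"
  proof (subst rec, rule tree_node_cong)
    fix i assume i: "i < p"
    have "fd ((dif 0, 0) [^]\<^bsub>L\<^esub> i) = (u, 0) [^]\<^bsub>L\<^esub> i"
      using fd.hom_nat_pow[of "(dif 0, 0)" i] dif_ker u by (simp add: L.nat_pow_consistent[symmetric])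
    moreover have "(dif 0, 0) [^]\<^bsub>L\<^esub> i \<in> ker"
      using K.nat_pow_closed[of "(dif 0, 0)" i] dif_ker by (simp add: L.nat_pow_consistent[symmetric])
    ultimately have "fd (coset_cocycle L p ker rep lamp_x i) = ((\<lambda>_. 0), n) \<otimes>\<^bsub>L\<^esub> (u, 0) [^]\<^bsub>L\<^esub> i"
      using fd.hom_mult[of lamp_x "(dif 0, 0) [^]\<^bsub>L\<^esub> i"] i x_ker n
      by (simp add: ker_coset_cocycle_x del: L_mult)
    \<comment> \<open>Coordinates are rewritten as a group word in \<open>a\<close> and
      \<open>x\<close>, through which the representation can be pushed.\<close>
    also have "\<dots> = lamp_x [^]\<^bsub>L\<^esub> n \<otimes>\<^bsub>L\<^esub> laurent_pow L lamp_a lamp_x u [^]\<^bsub>L\<^esub> i"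
      using \<open>u \<in> base\<close> p_gt_1 by (simp only: lamp_x_pow laurent_pow_lamp)
    also have "\<phi> \<dots> = \<phi> lamp_x [^]\<^bsub>tree_aut p\<^esub> n \<otimes>\<^bsub>tree_aut p\<^esub> \<phi> (laurent_pow L lamp_a lamp_x u) [^]\<^bsub>tree_aut p\<^esub> i"
    proof -
      have "laurent_pow L lamp_a lamp_x u \<in> carrier L"
        using \<open>u \<in> base\<close> by (simp add: laurent_pow_lamp)
      then show ?thesis
        by (simp only: \<phi>.hom_mult \<phi>.hom_nat_pow hom_int_pow[OF hom] lamp_x_carrier
            L.int_pow_closed L.nat_pow_closed L.is_group T.is_group)
    qed
    also have "\<phi> (laurent_pow L lamp_a lamp_x u) = laurent_pow (tree_aut p) (\<phi> lamp_a) (\<phi> lamp_x) u"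
      by (rule laurent_pow_hom[OF hom L.is_group T.is_group lamp_a_carrier lamp_x_carrier])
    finally show "\<phi> (fd (coset_cocycle L p ker rep lamp_x i)) = \<phi> lamp_x [^]\<^bsub>tree_aut p\<^esub> n \<otimes>\<^bsub>tree_aut p\<^esub>
           laurent_pow (tree_aut p) (\<phi> lamp_a) (\<phi> lamp_x) u [^]\<^bsub>tree_aut p\<^esub> i" .
    show "coset_perm L p ker rep lamp_x i = id i"
      using i by (simp add: ker_coset_perm lamp_x_carrier aug_hom_lamp_x del: carrier_L)
  qed
qed

section \<open>Normal subgroups given by vanishing moments\<close>

text \<open>One format for the three ideals tested against faithfulness: no weight gives
  \<open>A\<close>, the weight 1 gives \<open>(x - 1) A\<close>, and the weights 1 and
  \<open>j\<close> give \<open>(x - 1)^2 A\<close>.\<close>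

definition moment_ideal :: "(int \<Rightarrow> int) set \<Rightarrow> (int \<Rightarrow> int) set"
  where "moment_ideal M = {v \<in> base. \<forall>g\<in>M. [moment g v = 0] (mod int p)}"

text \<open>As \<open>A\<close> is abelian, conjugation acts on it only through the top component,
  that is by shifts.\<close>

lemma moment_ideal_normal:
  assumes shift: "\<And>v m. v \<in> moment_ideal M \<Longrightarrow> (\<lambda>j. v (j + m)) \<in> moment_ideal M"
  shows "moment_ideal M \<times> {0} \<lhd> L"
proof -
  have base: "v \<in> base" if "v \<in> moment_ideal M" for v
    using that by (simp add: moment_ideal_def)
  have add: "reduce (\<lambda>j. v j + w j) \<in> moment_ideal M"
    if "v \<in> moment_ideal M" "w \<in> moment_ideal M" for v w
    unfolding moment_ideal_def
  proof (intro CollectI conjI ballI)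
    show "reduce (\<lambda>j. v j + w j) \<in> base"
      using that by (intro reduce_base finite_support base)
    fix g assume "g \<in> M"
    then have "[moment g v + moment g w = 0 + 0] (mod int p)"
      using that by (intro cong_add) (auto simp: moment_ideal_def)
    with moment_reduce_add[OF base base, OF that, of g]
    show "[moment g (reduce (\<lambda>j. v j + w j)) = 0] (mod int p)"
      by (auto intro: cong_trans)
  qed
  have uminus: "reduce (\<lambda>j. - v j) \<in> moment_ideal M" if "v \<in> moment_ideal M" for v
    unfolding moment_ideal_def
  proof (intro CollectI conjI ballI)
    show "reduce (\<lambda>j. - v j) \<in> base"
      using that by (intro reduce_base finite_support base)
    fix g assume "g \<in> M"
    then have "[(- 1) * moment g v = (- 1) * 0] (mod int p)"
      using that by (intro cong_scalar_left) (auto simp: moment_ideal_def)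
    with moment_reduce_scale[OF base, OF that, of g "- 1"]
    show "[moment g (reduce (\<lambda>j. - v j)) = 0] (mod int p)"
      by (auto intro: cong_trans)
  qed
  have zero: "(\<lambda>_. 0) \<in> moment_ideal M"
    by (simp add: moment_ideal_def)
  have subgroup: "subgroup (moment_ideal M \<times> {0}) L"
  proof (rule L.subgroupI)
    show "moment_ideal M \<times> {0} \<noteq> {}" using zero by blast
  qed (use base add uminus in \<open>auto simp: L_inv\<close>)
  moreover have "g \<otimes>\<^bsub>L\<^esub> h \<otimes>\<^bsub>L\<^esub> inv\<^bsub>L\<^esub> g \<in> moment_ideal M \<times> {0}"
    if gc: "g \<in> carrier L" and hc: "h \<in> moment_ideal M \<times> {0}" for g h
  proof -
    obtain s m where g: "g = (s, m)" "s \<in> base" using gc by (cases g) simp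
    obtain v where h: "h = (v, 0)" "v \<in> moment_ideal M" using hc by (cases h) simp
    note gh = g(1) h(1) g(2) h(2)
    have "g \<otimes>\<^bsub>L\<^esub> h = ((\<lambda>j. v (j + m)), 0) \<otimes>\<^bsub>L\<^esub> g"
      by (simp add: gh add.commute)
    then have "g \<otimes>\<^bsub>L\<^esub> h \<otimes>\<^bsub>L\<^esub> inv\<^bsub>L\<^esub> g = ((\<lambda>j. v (j + m)), 0)"
    proof -
      have "((\<lambda>j. v (j + m)), 0) \<in> carrier L" "h \<in> carrier L"
        using base[OF shift[OF gh(4)]] base[OF gh(4)] gh by auto
      then show ?thesis
        using \<open>g \<otimes>\<^bsub>L\<^esub> h = _\<close> gc by (simp only: L.inv_solve_right' L.m_closed)
    qed
    then show ?thesis using shift[OF gh(4)] by simp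
  qed
  ultimately show ?thesis
    unfolding L.normal_inv_iff by blast
qed

lemma moment_ideal_empty: "moment_ideal {} = base"
  by (simp add: moment_ideal_def)

lemma moment_ideal_aug: "moment_ideal {\<lambda>_. 1} = aug_ideal"
  by (simp add: moment_ideal_def aug_ideal_def)

lemma moment_ideal_aug_deriv:
  "moment_ideal {\<lambda>_. 1, \<lambda>j. j} = {v \<in> aug_ideal. [moment (\<lambda>j. j) v = 0] (mod int p)}"
  by (auto simp: moment_ideal_def aug_ideal_def)

text \<open>Modulo \<open>p\<close> the derivative is thus shift invariant where the augmentation
  vanishes, and also when \<open>p\<close> divides the shift; both cases occur below.\<close>

lemma deriv_shift: "moment (\<lambda>j. j) (\<lambda>j. v (j + m)) = moment (\<lambda>j. j) v - m * aug v"
  using moment_affine[of "\<lambda>j. j" "- m" "\<lambda>_. 1" v] by (simp add: moment_shift)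

end

section \<open>Pairs with a normal subgroup of prime index\<close>

locale lamplighter_pair = lamplighter +
  fixes H :: "((int \<Rightarrow> int) \<times> int) set"
    and f :: "(int \<Rightarrow> int) \<times> int \<Rightarrow> (int \<Rightarrow> int) \<times> int"
    and t :: "nat \<Rightarrow> (int \<Rightarrow> int) \<times> int"
  assumes normal_H: "H \<lhd> L"
    and card_rcosets: "card (rcosets\<^bsub>L\<^esub> H) = p"
    and pair: "similarity_pair L p H f"
    and transversal: "right_transversal L p H t"
    and faithful: "inj_on (sc_rep L p H f t) (carrier L)"
begin

section \<open>The action of \<open>f\<close> on top components and on elements of the base
  group\<close>

lemma subgroup_H: "subgroup H L"
  using pair by (simp add: similarity_pair_def)

sublocale H: group "L\<lparr>carrier := H\<rparr>"
  by (rule L.subgroup_imp_group[OF subgroup_H])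

sublocale f: group_hom "L\<lparr>carrier := H\<rparr>" L f
  using pair by (simp add: group_hom_def group_hom_axioms_def similarity_pair_def L.is_group H.is_group)

lemma H_base: "(s, m) \<in> H \<Longrightarrow> s \<in> base"
  using subgroup.subset[OF subgroup_H] by auto

lemma H_mult: "g \<in> H \<Longrightarrow> h \<in> H \<Longrightarrow> g \<otimes>\<^bsub>L\<^esub> h \<in> H"
  by (rule subgroup.m_closed[OF subgroup_H])

lemma H_pow: "g \<in> H \<Longrightarrow> g [^]\<^bsub>L\<^esub> (k :: int) \<in> H"
  by (rule L.subgroup_int_pow_closed[OF subgroup_H])

lemma snd_f_hom: "(\<lambda>g. snd (f g)) \<in> hom (L\<lparr>carrier := H\<rparr>) integer_group"
proof (rule homI)
  fix g h assume "g \<in> carrier (L\<lparr>carrier := H\<rparr>)" "h \<in> carrier (L\<lparr>carrier := H\<rparr>)"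
  then have "f (g \<otimes>\<^bsub>L\<^esub> h) = f g \<otimes>\<^bsub>L\<^esub> f h"
    using f.hom_mult by simp
  then show "snd (f (g \<otimes>\<^bsub>L\<lparr>carrier := H\<rparr>\<^esub> h)) = snd (f g) \<otimes>\<^bsub>integer_group\<^esub> snd (f h)"
    by (cases "f g"; cases "f h") simp
qed simp

lemma snd_f_mult: "g \<in> H \<Longrightarrow> h \<in> H \<Longrightarrow> snd (f (g \<otimes>\<^bsub>L\<^esub> h)) = snd (f g) + snd (f h)"
  using hom_mult[OF snd_f_hom] by simp

lemma snd_f_pow: 
  assumes "g \<in> H"
  shows "snd (f (g [^]\<^bsub>L\<^esub> (k :: int))) = k * snd (f g)"
proof -
  have "snd (f (g [^]\<^bsub>L\<lparr>carrier := H\<rparr>\<^esub> k)) = snd (f g) [^]\<^bsub>integer_group\<^esub> k"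
    by (rule hom_int_pow[OF snd_f_hom]) (use assms H.is_group in auto)
  then show ?thesis
    using assms by (simp add: L.int_pow_consistent[OF subgroup_H, symmetric] mult.commute)
qed

text \<open>Elements of \<open>A\<close> have exponent \<open>p\<close>, whereas the top group is
  torsion-free.\<close>

lemma snd_f_base:
  assumes "(v, 0) \<in> H"
  shows "snd (f (v, 0)) = 0"
proof -
  have "(v, 0) [^]\<^bsub>L\<^esub> int p = \<one>\<^bsub>L\<^esub>"
    by (simp add: base_pow[OF H_base[OF assms]] reduce_def)
  then have "int p * snd (f (v, 0)) = 0"
    using snd_f_pow[OF assms, of "int p"] f.hom_one by simp
  then show ?thesis using p_gt_1 by simp
qed

lemma f_base_eq: "(v, 0) \<in> H \<Longrightarrow> f (v, 0) = (fst (f (v, 0)), 0)"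
  using snd_f_base[of v] by (metis prod.collapse)

lemma fst_f_base: "g \<in> H \<Longrightarrow> fst (f g) \<in> base"
  using f.hom_closed[of g] by (auto simp: mem_Times_iff)

text \<open>The form in which faithfulness is used: an \<open>f\<close>-invariant moment ideal
  inside \<open>H\<close> contradicts it unless the ideal is zero.\<close>

lemma moment_ideal_trivial:
  assumes shift: "\<And>v m. v \<in> moment_ideal M \<Longrightarrow> (\<lambda>j. v (j + m)) \<in> moment_ideal M"
    and H: "moment_ideal M \<times> {0} \<subseteq> H"
    and inv: "\<And>v. v \<in> moment_ideal M \<Longrightarrow> fst (f (v, 0)) \<in> moment_ideal M"
    and v: "v \<in> moment_ideal M"
  shows "v = (\<lambda>_. 0)"
proof -
  have "f ` (moment_ideal M \<times> {0}) \<subseteq> moment_ideal M \<times> {0}"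
  proof
    fix g assume "g \<in> f ` (moment_ideal M \<times> {0})"
    then obtain w where w: "w \<in> moment_ideal M" "g = f (w, 0)" by auto
    then have "(w, 0) \<in> H" using H by blast
    then show "g \<in> moment_ideal M \<times> {0}"
      using f_base_eq[of w] w inv[OF w(1)] by (metis SigmaI singletonI)
  qed
  then have "moment_ideal M \<times> {0} = {\<one>\<^bsub>L\<^esub>}"
    by (intro sc_rep_faithful_imp_simple[OF L.is_group pair transversal faithful]
        moment_ideal_normal shift H)
  moreover have "(v, 0) \<in> moment_ideal M \<times> {0}" using v by simp
  ultimately have "(v, 0) = \<one>\<^bsub>L\<^esub>" by blast
  then show ?thesis by simp
qed

text \<open>Otherwise \<open>A\<close> itself would be normal, nontrivial and
  \<open>f\<close>-invariant.\<close>

lemma not_base_subset_H: "\<not> base \<times> {0} \<subseteq> H"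
proof
  assume H: "base \<times> {0} \<subseteq> H"
  have "(\<lambda>i :: int. of_bool (i = 0) :: int) = (\<lambda>_. 0)"
  proof (rule moment_ideal_trivial[of "{}", unfolded moment_ideal_empty])
    show "fst (f (v, 0)) \<in> base" if "v \<in> base" for v
      using that H by (intro fst_f_base) blast
  qed (use H base_shift in auto)
  then have "(of_bool ((0 :: int) = 0) :: int) = 0" by (rule fun_cong)
  then show False by simp
qed

text \<open>Each generator \<open>dif j\<close> is a commutator of \<open>x\<close> with a conjugate
  of \<open>a\<close>, and commutators lie in \<open>H\<close> because the quotient is
  abelian.\<close>

lemma aug_ideal_H: "v \<in> aug_ideal \<Longrightarrow> (v, 0) \<in> H"
proof (induction v rule: aug_ideal_induct)
  case zero
  show ?case using subgroup.one_closed[OF subgroup_H] by simp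
next
  case (add v w)
  then show ?case using H_mult[of "(v, 0)" "(w, 0)"] by simp
next
  case (dif j)
  let ?x = lamp_x and ?y = "((\<lambda>i. of_bool (i = j + 1)), 0) :: (int \<Rightarrow> int) \<times> int"
  have "reduce (\<lambda>i. dif j i + of_bool (i + 1 = j + 1)) = reduce (\<lambda>i. of_bool (i = j + 1))"
    by (rule reduce_cong) (simp add: dif_def reduce_def cong_def mod_simps)
  then have "?y \<otimes>\<^bsub>L\<^esub> ?x = (dif j, 0) \<otimes>\<^bsub>L\<^esub> (?x \<otimes>\<^bsub>L\<^esub> ?y)"
    by (simp add: lamp_x_def reduce_eq)
  then have "?y \<otimes>\<^bsub>L\<^esub> ?x \<otimes>\<^bsub>L\<^esub> inv\<^bsub>L\<^esub> (?x \<otimes>\<^bsub>L\<^esub> ?y) = (dif j, 0)"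
    by (intro L.inv_solve_right'[THEN iffD2] L.m_closed lamp_x_carrier) simp_all
  then show ?case
    using normal.commutator_mem_of_prime_index[OF normal_H, of ?y ?x] p_prime card_rcosets lamp_x_carrier
    by simp
qed

text \<open>An element of \<open>A\<close> in \<open>H\<close> with invertible augmentation would,
  together with \<open>(x - 1) A\<close>, generate all of \<open>A\<close> inside
  \<open>H\<close>.\<close>

lemma base_H_iff:
  assumes "v \<in> base"
  shows "(v, 0) \<in> H \<longleftrightarrow> v \<in> aug_ideal"
proof
  assume v: "(v, 0) \<in> H"
  show "v \<in> aug_ideal"
  proof (rule ccontr)
    assume "v \<notin> aug_ideal"
    then have "\<not> int p dvd aug v"
      using assms by (simp add: aug_ideal_def cong_0_iff)
    then have "coprime (aug v) (int p)"
      using p_prime prime_imp_coprime[of "int p" "aug v"] by (simp add: coprime_commute)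
    then obtain c where c: "[aug v * c = 1] (mod int p)"
      using cong_solve_coprime_int by blast
    have "(w, 0) \<in> H" if w: "w \<in> base" for w
    proof -
      \<comment> \<open>With \<open>c\<close> inverse to the augmentation of \<open>v\<close>, this
        multiple of \<open>v\<close> has the augmentation of \<open>w\<close>, so the difference
        lies in the augmentation ideal.\<close>
      let ?c = "c * aug w"
      let ?cv = "reduce (\<lambda>j. ?c * v j)"
      have cv: "?cv \<in> base" by (intro reduce_base finite_support assms)
      have "[aug ?cv = ?c * aug v] (mod int p)"
        using assms by (rule moment_reduce_scale)
      also have "[?c * aug v = aug w * 1] (mod int p)"
        using cong_scalar_left[OF c, of "aug w"] by (simp add: mult_ac)
      finally have "[aug w - aug ?cv = aug w - aug w] (mod int p)"
        by (intro cong_diff) (simp_all add: cong_sym)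
      then have "reduce (\<lambda>j. w j - ?cv j) \<in> aug_ideal"
        using moment_reduce_diff[OF w cv, of "\<lambda>_. 1"] w cv
        by (auto simp: aug_ideal_def intro: cong_trans intro!: reduce_base finite_support_diff[OF base_finite base_finite])
      then have "(reduce (\<lambda>j. w j - ?cv j), 0) \<otimes>\<^bsub>L\<^esub> (v, 0) [^]\<^bsub>L\<^esub> ?c \<in> H"
        by (intro H_mult H_pow aug_ideal_H v)
      moreover have "reduce (\<lambda>j. reduce (\<lambda>j. w j - d j) j + d j) = reduce w" for d
        by (simp add: reduce_def mod_simps)
      ultimately show ?thesis
        using w by (simp add: base_pow[OF assms] reduce_eq)
    qed
    then show False using not_base_subset_H by auto
  qed
qed (rule aug_ideal_H)

text \<open>This amounts to \<open>A H = G\<close>. The powers \<open>rep i\<close> are incongruent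
  modulo \<open>H\<close>, since \<open>A\<close> meets \<open>H\<close> only in
  \<open>(x - 1) A\<close>; as the index is \<open>p\<close> they represent all cosets. So
  \<open>x^k = h a^i\<close> for some \<open>h\<close> in \<open>H\<close>, and \<open>h\<close>
  lies above \<open>x^k\<close>.\<close>

lemma ex_H_snd: "\<exists>s. (s, k) \<in> H"
proof -
  have inj: "inj_on (\<lambda>i. H #>\<^bsub>L\<^esub> rep i) {..<p}"
  proof (rule inj_onI)
    fix i j assume ij: "i \<in> {..<p}" "j \<in> {..<p}" and eq: "H #>\<^bsub>L\<^esub> rep i = H #>\<^bsub>L\<^esub> rep j"
    have rc: "rep i \<in> carrier L" "rep j \<in> carrier L" using ij rep_carrier by auto
    have "rep i \<in> H #>\<^bsub>L\<^esub> rep j"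
      using L.rcos_self[OF rc(1) subgroup_H] eq by simp
    then have "rep i \<otimes>\<^bsub>L\<^esub> inv\<^bsub>L\<^esub> rep j \<in> H"
      using subgroup.rcos_module[OF subgroup_H L.is_group] rc by blast
    moreover obtain v where v: "rep i \<otimes>\<^bsub>L\<^esub> inv\<^bsub>L\<^esub> rep j = (v, 0)" "v \<in> base"
    proof -
      have "rep i \<otimes>\<^bsub>L\<^esub> inv\<^bsub>L\<^esub> rep j \<in> carrier L"
        using rc by (intro L.m_closed L.inv_closed)
      moreover have "snd (rep i \<otimes>\<^bsub>L\<^esub> inv\<^bsub>L\<^esub> rep j) = 0"
        using rc by (simp add: rep_def L_inv)
      ultimately show ?thesis using that by (metis carrier_L mem_Sigma_iff prod.collapse)
    qed
    ultimately have "v \<in> aug_ideal" using base_H_iff by simp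
    then have "rep i \<otimes>\<^bsub>L\<^esub> inv\<^bsub>L\<^esub> rep j \<in> ker" by (simp add: v ker_def)
    then have "rep i \<in> ker #>\<^bsub>L\<^esub> rep j"
      using subgroup.rcos_module[OF ker_subgroup L.is_group] rc by blast
    then have "ker #>\<^bsub>L\<^esub> rep i = ker #>\<^bsub>L\<^esub> rep j"
      using L.repr_independence[OF _ _ ker_subgroup] rc by metis
    then have "aug_hom (rep i) = aug_hom (rep j)"
      using rc ker_coset_eq_iff by blast
    then show "i = j" using ij by (simp add: aug_hom_rep)
  qed
  have "(\<lambda>i. H #>\<^bsub>L\<^esub> rep i) ` {..<p} = rcosets\<^bsub>L\<^esub> H"
  proof (rule card_subset_eq)
    show "finite (rcosets\<^bsub>L\<^esub> H)" using pair by (simp add: similarity_pair_def)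
    show "(\<lambda>i. H #>\<^bsub>L\<^esub> rep i) ` {..<p} \<subseteq> rcosets\<^bsub>L\<^esub> H"
      using rep_carrier by (auto simp: RCOSETS_def simp del: carrier_L)
    show "card ((\<lambda>i. H #>\<^bsub>L\<^esub> rep i) ` {..<p}) = card (rcosets\<^bsub>L\<^esub> H)"
      by (simp add: card_image[OF inj] card_rcosets)
  qed
  let ?g = "((\<lambda>_. 0), k) :: (int \<Rightarrow> int) \<times> int"
  have g: "?g \<in> carrier L" by simp
  then have "H #>\<^bsub>L\<^esub> ?g \<in> rcosets\<^bsub>L\<^esub> H" unfolding RCOSETS_def by blast
  then obtain i where i: "i < p" "H #>\<^bsub>L\<^esub> ?g = H #>\<^bsub>L\<^esub> rep i"
    using \<open>_ = rcosets\<^bsub>L\<^esub> H\<close> by blast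
  then have "?g \<in> H #>\<^bsub>L\<^esub> rep i"
    using L.rcos_self[OF g subgroup_H] by simp
  then obtain h where h: "h \<in> H" "?g = h \<otimes>\<^bsub>L\<^esub> rep i"
    by (auto simp: r_coset_def)
  then have "snd h = k"
    by (cases h) (simp add: rep_def)
  then show ?thesis using h(1) by (metis prod.collapse)
qed

section \<open>The maps induced by \<open>f\<close> on \<open>(x - 1) A\<close> and on the top
  group\<close>

definition f_base :: "(int \<Rightarrow> int) \<Rightarrow> int \<Rightarrow> int"
  where "f_base v = fst (f (v, 0))"

text \<open>The exponent \<open>n\<close> by which \<open>f\<close> acts on the top group, read off
  at some element of \<open>H\<close> above \<open>x\<close>; \<open>snd_f\<close> shows that the
  choice is immaterial.\<close>

definition f_top :: int
  where "f_top = snd (f (SOME h. h \<in> H \<and> snd h = 1))"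

abbreviation f_unit :: "int \<Rightarrow> int"
  where "f_unit \<equiv> f_base (dif 0)"

lemma f_aug_ideal: "v \<in> aug_ideal \<Longrightarrow> f (v, 0) = (f_base v, 0)"
  unfolding f_base_def by (intro f_base_eq aug_ideal_H)

lemma f_base_closed: "v \<in> aug_ideal \<Longrightarrow> f_base v \<in> base"
  unfolding f_base_def by (intro fst_f_base aug_ideal_H)

text \<open>Multiplying by the power \<open>- k\<close> of the chosen element above \<open>x\<close>
  lands in \<open>A\<close>, where \<open>f\<close> has trivial top component.\<close>

lemma snd_f:
  assumes "(s, k) \<in> H"
  shows "snd (f (s, k)) = f_top * k"
proof -
  define h where "h = (SOME h. h \<in> H \<and> snd h = 1)"
  have "\<exists>h. h \<in> H \<and> snd h = 1" using ex_H_snd[of 1] by auto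
  then have h: "h \<in> H" "snd h = 1"
    unfolding h_def by (rule someI2_ex, simp)+
  have snd_hom: "snd \<in> hom L integer_group"
    by (rule homI) auto
  have "snd (h [^]\<^bsub>L\<^esub> - k) = snd h [^]\<^bsub>integer_group\<^esub> (- k)"
    using subgroup.mem_carrier[OF subgroup_H h(1)]
    by (rule hom_int_pow[OF snd_hom]) (simp_all add: L.is_group)
  then have "snd (h [^]\<^bsub>L\<^esub> - k) = - k" using h(2) by simp
  then obtain z where z: "h [^]\<^bsub>L\<^esub> - k = (z, - k)" by (metis prod.collapse)
  have mem: "(s, k) \<otimes>\<^bsub>L\<^esub> h [^]\<^bsub>L\<^esub> - k \<in> H"
    using assms h by (intro H_mult H_pow)
  then have "snd (f ((s, k) \<otimes>\<^bsub>L\<^esub> h [^]\<^bsub>L\<^esub> - k)) = 0"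
    unfolding z L_mult add.right_inverse by (rule snd_f_base)
  moreover have "snd (f ((s, k) \<otimes>\<^bsub>L\<^esub> h [^]\<^bsub>L\<^esub> - k)) = snd (f (s, k)) + - k * f_top"
    unfolding snd_f_mult[OF assms H_pow[OF h(1)]] snd_f_pow[OF h(1)] by (simp add: f_top_def h_def)
  ultimately show ?thesis by (simp add: mult.commute)
qed

lemma f_base_add:
  assumes "v \<in> aug_ideal" "w \<in> aug_ideal"
  shows "f_base (reduce (\<lambda>j. v j + w j)) = reduce (\<lambda>j. f_base v j + f_base w j)"
proof -
  have "f ((v, 0) \<otimes>\<^bsub>L\<^esub> (w, 0)) = f (v, 0) \<otimes>\<^bsub>L\<^esub> f (w, 0)"
    using f.hom_mult[of "(v, 0)" "(w, 0)"] assms by (simp add: aug_ideal_H)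
  then show ?thesis
    using assms by (simp add: f_aug_ideal aug_ideal_add)
qed

text \<open>Conjugation by an element of \<open>H\<close> above \<open>x ^ k\<close> shows that \<open>f\<close> is semilinear.\<close>

lemma f_base_shift:
  assumes v: "v \<in> aug_ideal"
  shows "f_base (\<lambda>j. v (j + k)) = (\<lambda>j. f_base v (j + f_top * k))"
proof -
  obtain s where s: "(s, k) \<in> H" using ex_H_snd by blast
  obtain w where w: "f (s, k) = (w, f_top * k)" "w \<in> base"
    using snd_f[OF s] fst_f_base[OF s] by (metis prod.collapse)
  let ?v = "\<lambda>j. v (j + k)"
  have v': "?v \<in> aug_ideal" by (rule aug_ideal_shift[OF v])
  have "(s, k) \<otimes>\<^bsub>L\<^esub> (v, 0) = (?v, 0) \<otimes>\<^bsub>L\<^esub> (s, k)"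
    by (simp add: add.commute)
  then have "f (s, k) \<otimes>\<^bsub>L\<^esub> f (v, 0) = f (?v, 0) \<otimes>\<^bsub>L\<^esub> f (s, k)"
    using f.hom_mult[of "(s, k)" "(v, 0)"] f.hom_mult[of "(?v, 0)" "(s, k)"] s v v'
    by (simp add: aug_ideal_H del: L_mult L_mult_base)
  then have "reduce (\<lambda>j. w j + f_base v (j + f_top * k)) = reduce (\<lambda>j. f_base ?v j + w j)"
    by (simp add: f_aug_ideal v v' w)
  then have "(w j + f_base v (j + f_top * k)) mod int p = (f_base ?v j + w j) mod int p" for j
    unfolding reduce_def by meson
  then have "[w j + f_base v (j + f_top * k) = w j + f_base ?v j] (mod int p)" for j
    by (simp add: cong_def add.commute)
  then have "[f_base v (j + f_top * k) = f_base ?v j] (mod int p)" for j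
    by (simp only: cong_add_lcancel)
  then have "reduce (\<lambda>j. f_base v (j + f_top * k)) = reduce (f_base ?v)"
    by (rule reduce_cong)
  then show ?thesis
    using f_base_closed[OF v] f_base_closed[OF v'] by (simp add: reduce_eq base_shift)
qed

text \<open>Evaluating \<open>r(x^n) u(x)\<close> at 1 gives \<open>r(1) u(1)\<close>, and
  \<open>r(1)\<close> is the derivative of \<open>(x - 1) r\<close> at 1. Formally, \<open>f\<close>
  turns shifts into shifts and the augmentation ignores them.\<close>

lemma aug_f_base:
  assumes "v \<in> aug_ideal"
  shows "[aug (f_base v) = aug f_unit * moment (\<lambda>j. j) v] (mod int p)"
proof (rule shift_invariant_on_aug_ideal[where F = "\<lambda>v. aug (f_base v)"])
  fix v w assume "v \<in> aug_ideal" "w \<in> aug_ideal"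
  then show "[aug (f_base (reduce (\<lambda>j. v j + w j))) = aug (f_base v) + aug (f_base w)] (mod int p)"
    by (subst f_base_add) (auto intro: moment_reduce_add f_base_closed)
qed (use assms in \<open>simp_all add: f_base_shift moment_shift\<close>)

text \<open>The derivative of \<open>r(x^n) u(x)\<close> at 1 is
  \<open>n r'(1) u(1) + r(1) u'(1)\<close>, and its first term vanishes when \<open>p\<close>
  divides \<open>n\<close>.\<close>

lemma deriv_f_base:
  assumes "v \<in> aug_ideal" and n: "int p dvd f_top"
  shows "[moment (\<lambda>j. j) (f_base v) = moment (\<lambda>j. j) f_unit * moment (\<lambda>j. j) v] (mod int p)"
proof (rule shift_invariant_on_aug_ideal[where F = "\<lambda>v. moment (\<lambda>j. j) (f_base v)"])
  fix v w assume "v \<in> aug_ideal" "w \<in> aug_ideal"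
  then show "[moment (\<lambda>j. j) (f_base (reduce (\<lambda>j. v j + w j))) =
      moment (\<lambda>j. j) (f_base v) + moment (\<lambda>j. j) (f_base w)] (mod int p)"
    by (subst f_base_add) (auto intro: moment_reduce_add f_base_closed)
next
  fix v assume "v \<in> aug_ideal"
  then show "[moment (\<lambda>j. j) (f_base (\<lambda>j. v (j + 1))) = moment (\<lambda>j. j) (f_base v)] (mod int p)"
    using n by (simp add: f_base_shift deriv_shift cong_iff_dvd_diff)
qed (rule assms(1))

section \<open>Consequences of faithfulness for \<open>u\<close> and \<open>n\<close>\<close>

lemma dif_nonzero: "dif 0 \<noteq> (\<lambda>_. 0)"
proof
  assume "dif 0 = (\<lambda>_. 0)"
  then have "dif 0 1 = 0" by (rule fun_cong)
  then show False using p_gt_1 by (simp add: dif_def reduce_def)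
qed

text \<open>If \<open>u(1)\<close> were 0, \<open>aug_f_base\<close> would make
  \<open>(x - 1) A\<close> invariant under \<open>f\<close>.\<close>

lemma aug_f_unit: "\<not> [aug f_unit = 0] (mod int p)"
proof
  assume u: "[aug f_unit = 0] (mod int p)"
  have "dif 0 = (\<lambda>_. 0)"
  proof (rule moment_ideal_trivial[of "{\<lambda>_. 1}", unfolded moment_ideal_aug])
    fix v assume v: "v \<in> aug_ideal"
    have "[aug (f_base v) = 0 * moment (\<lambda>j. j) v] (mod int p)"
      using aug_f_base[OF v] cong_scalar_right[OF u] by (rule cong_trans)
    then show "fst (f (v, 0)) \<in> aug_ideal"
      using f_base_closed[OF v] by (simp add: aug_ideal_def f_base_def)
  qed (use aug_ideal_H aug_ideal_shift in auto)
  then show False using dif_nonzero by blast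
qed

text \<open>If \<open>p\<close> divided \<open>n\<close>, both the augmentation and the derivative
  of the image would be multiples of the derivative of \<open>v\<close>, making
  \<open>(x - 1)^2 A\<close> invariant.\<close>

lemma coprime_f_top: "gcd (int p) f_top = 1"
proof (rule ccontr)
  assume "gcd (int p) f_top \<noteq> 1"
  then have "\<not> coprime (int p) f_top" by (simp add: coprime_iff_gcd_eq_1)
  then have n: "int p dvd f_top"
    using p_prime prime_imp_coprime[of "int p" f_top] by auto
  \<comment> \<open>This is \<open>(x - 1)^2\<close>, a nonzero member of the ideal; its moments are
    second differences of the weight.\<close>
  let ?v = "reduce (\<lambda>i. dif 1 i - dif 0 i)"
  let ?I = "{v \<in> aug_ideal. [moment (\<lambda>j. j) v = 0] (mod int p)}"
  have v: "?v \<in> ?I"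
  proof -
    have "[moment g ?v = g 2 + g 0 - 2 * g 1] (mod int p)" for g
    proof -
      have "[moment g ?v = moment g (dif 1) - moment g (dif 0)] (mod int p)"
        by (intro moment_reduce_diff dif_base)
      also have "[moment g (dif 1) - moment g (dif 0) = (g (1 + 1) - g 1) - (g (0 + 1) - g 0)] (mod int p)"
        by (intro cong_diff moment_dif)
      finally show ?thesis by simp
    qed
    from this[of "\<lambda>_. 1"] this[of "\<lambda>j. j"] show ?thesis
      using reduce_base[OF finite_support_diff[OF dif_base[THEN base_finite] dif_base[THEN base_finite]]]
      by (simp add: aug_ideal_def)
  qed
  have "?v = (\<lambda>_. 0)"
  proof (rule moment_ideal_trivial[of "{\<lambda>_. 1, \<lambda>j. j}", unfolded moment_ideal_aug_deriv])
    fix v m assume v: "v \<in> ?I"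
    have "[moment (\<lambda>j. j) v - m * aug v = 0 - m * 0] (mod int p)"
      using v by (intro cong_diff cong_scalar_left) (auto simp: aug_ideal_def)
    then show "(\<lambda>j. v (j + m)) \<in> ?I"
      using v by (simp add: deriv_shift aug_ideal_shift)
  next
    fix v assume "v \<in> ?I"
    then have v: "v \<in> aug_ideal" "[moment (\<lambda>j. j) v = 0] (mod int p)" by auto
    have "[c * moment (\<lambda>j. j) v = c * 0] (mod int p)" for c
      by (intro cong_scalar_left v)
    then show "fst (f (v, 0)) \<in> ?I"
      using aug_f_base[OF v(1)] deriv_f_base[OF v(1) n] f_base_closed[OF v(1)]
      unfolding f_base_def[symmetric] by (auto simp: aug_ideal_def intro: cong_trans)
  qed (use v aug_ideal_H in auto)
  \<comment> \<open>The coefficient of \<open>x^2\<close> in \<open>(x - 1)^2\<close> is 1 for every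
    \<open>p\<close>, including 2.\<close>
  then have "?v 2 = 0" by (rule fun_cong)
  then show False using p_gt_1 by (simp add: dif_def reduce_def)
qed

section \<open>The split pair and its representation\<close>

definition split_f :: "(int \<Rightarrow> int) \<times> int \<Rightarrow> (int \<Rightarrow> int) \<times> int"
  where "split_f g = (f_base (fst g), f_top * snd g)"

text \<open>Semilinearity, in the form \<open>f_base_shift\<close>, is exactly compatibility with
  the twisted product.\<close>

lemma split_f_hom: "split_f \<in> hom (L\<lparr>carrier := ker\<rparr>) L"
proof (rule homI)
  fix g h assume "g \<in> carrier (L\<lparr>carrier := ker\<rparr>)" "h \<in> carrier (L\<lparr>carrier := ker\<rparr>)"
  then obtain v k w l where "g = (v, k)" "h = (w, l)" "v \<in> aug_ideal" "w \<in> aug_ideal"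
    by (auto simp: ker_def)
  then show "split_f (g \<otimes>\<^bsub>L\<lparr>carrier := ker\<rparr>\<^esub> h) = split_f g \<otimes>\<^bsub>L\<^esub> split_f h"
    by (simp add: split_f_def f_base_add f_base_shift aug_ideal_shift ring_distribs)
qed (auto simp: split_f_def ker_def f_base_closed)

lemma split_f_dif: "split_f (dif 0, 0) = (f_unit, 0)"
  by (simp add: split_f_def)

lemma f_base_zero: "f_base (\<lambda>_. 0) = (\<lambda>_. 0)"
  using f.hom_one by (simp add: f_base_def)

lemma split_f_lamp_x: "split_f lamp_x = ((\<lambda>_. 0), f_top)"
  by (simp add: split_f_def lamp_x_def f_base_zero)

lemma A_inter_H: "lamp_A p \<inter> H = aug_ideal \<times> {0}"
  using base_H_iff H_base aug_ideal_base by (auto simp: lamp_A_eq)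

lemma AH_inter_X: "(lamp_A p <#>\<^bsub>L\<^esub> H) \<inter> lamp_X p = lamp_X p"
proof -
  have "((\<lambda>_. 0), k) \<in> lamp_A p <#>\<^bsub>L\<^esub> H" for k
  proof -
    obtain s where s: "(s, k) \<in> H" using ex_H_snd by blast
    let ?s = "reduce (\<lambda>j. - s j)"
    have "?s \<in> base" by (intro reduce_base finite_support H_base[OF s])
    moreover have "((\<lambda>_. 0), k) = (?s, 0) \<otimes>\<^bsub>L\<^esub> (s, k)"
      by (simp add: reduce_def mod_simps)
    ultimately show ?thesis
      using s unfolding set_mult_def lamp_A_eq by blast
  qed
  then show ?thesis by (auto simp: lamp_X_eq')
qed

lemma ker_eq_split: "ker = (lamp_A p \<inter> H) <#>\<^bsub>L\<^esub> ((lamp_A p <#>\<^bsub>L\<^esub> H) \<inter> lamp_X p)"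
proof -
  have eq: "(v, 0) \<otimes>\<^bsub>L\<^esub> ((\<lambda>_. 0), k) = (v, k)" if "v \<in> aug_ideal" for v k
    using aug_ideal_base[OF that] by (simp add: reduce_eq)
  have "aug_ideal \<times> UNIV = (aug_ideal \<times> {0}) <#>\<^bsub>L\<^esub> ({\<lambda>_. 0} \<times> UNIV)"
  proof (intro equalityI subsetI)
    fix g :: "(int \<Rightarrow> int) \<times> int" assume "g \<in> aug_ideal \<times> UNIV"
    then obtain v k where g: "g = (v, k)" "v \<in> aug_ideal" by blast
    then have "g = (v, 0) \<otimes>\<^bsub>L\<^esub> ((\<lambda>_. 0), k)" by (simp only: eq)
    then show "g \<in> (aug_ideal \<times> {0}) <#>\<^bsub>L\<^esub> ({\<lambda>_. 0} \<times> UNIV)"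
      unfolding set_mult_def using g(2) by blast
  next
    fix g assume "g \<in> (aug_ideal \<times> {0}) <#>\<^bsub>L\<^esub> ({\<lambda>_. 0} \<times> UNIV)"
    then obtain v k where "v \<in> aug_ideal" "g = (v, 0) \<otimes>\<^bsub>L\<^esub> ((\<lambda>_. 0), k)"
      unfolding set_mult_def by blast
    then show "g \<in> aug_ideal \<times> UNIV" by (simp only: eq) simp
  qed
  then show ?thesis
    unfolding A_inter_H AH_inter_X unfolding lamp_X_eq' ker_def .
qed

text \<open>A single splitting step suffices. Since \<open>v y\<close> lies above
  \<open>y = x^k\<close>, \<open>snd_f\<close> forces \<open>y'\<close> to be \<open>x^(n k)\<close>
  whatever \<open>v\<close> and \<open>w\<close> are chosen.\<close>

lemma split_f_reduction:
  "pair_reduction L (lamp_A p) (lamp_X p) lamp_a H f ker split_f"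
proof (rule pair_reduction.split[OF pair_reduction.refl ker_eq_split])
  fix a0 y v w y'
  assume a0: "a0 \<in> lamp_A p \<inter> H" and y: "y \<in> (lamp_A p <#>\<^bsub>L\<^esub> H) \<inter> lamp_X p"
    and v: "v \<in> lamp_A p" "v \<otimes>\<^bsub>L\<^esub> y \<in> H"
    and w: "w \<in> lamp_A p" and y': "y' \<in> lamp_X p" and f: "f (v \<otimes>\<^bsub>L\<^esub> y) = w \<otimes>\<^bsub>L\<^esub> y'"
  obtain b where b: "a0 = (b, 0)" "b \<in> aug_ideal" using a0 unfolding A_inter_H by auto
  obtain k where k: "y = ((\<lambda>_. 0), k)" using y unfolding AH_inter_X lamp_X_eq' by auto
  obtain l where l: "y' = ((\<lambda>_. 0), l)" using y' unfolding lamp_X_eq' by auto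
  obtain c where c: "v = (c, 0)" "c \<in> base" using v unfolding lamp_A_eq by auto
  obtain d where d: "w = (d, 0)" using w unfolding lamp_A_eq by auto
  have "v \<otimes>\<^bsub>L\<^esub> y = (c, k)" using c by (simp add: k reduce_eq)
  then have "l = f_top * k"
    using snd_f[of c k] v(2) f by (simp add: d l)
  then show "split_f (a0 \<otimes>\<^bsub>L\<^esub> y) = f a0 \<otimes>\<^bsub>L\<^esub> y'"
    using b by (simp add: k l split_f_def f_aug_ideal reduce_eq aug_ideal_base f_base_closed)
qed

lemma reducible_to_split:
  "reducible_to L (lamp_A p) (lamp_X p) lamp_a p H f (sc_rep L p ker split_f rep)"
  unfolding reducible_to_def
  using split_f_reduction ker_similarity_pair[OF split_f_hom] ker_transversal by blast

end

theorem theorem2: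
  fixes p :: nat
    and H :: "((int \<Rightarrow> int) \<times> int) set"
    and f :: "(int \<Rightarrow> int) \<times> int \<Rightarrow> (int \<Rightarrow> int) \<times> int"
    and t :: "nat \<Rightarrow> (int \<Rightarrow> int) \<times> int"
  assumes "Factorial_Ring.prime p"
    and "H \<lhd> lamp p"
    and "card (rcosets\<^bsub>lamp p\<^esub> H) = p"
    and "similarity_pair (lamp p) p H f"
    and "right_transversal (lamp p) p H t"
    and faithful: "inj_on (sc_rep (lamp p) p H f t) (carrier (lamp p))"
  shows "\<exists>\<phi> (n :: int) u \<alpha> \<xi>.
    reducible_to (lamp p) (lamp_A p) (lamp_X p) lamp_a p H f \<phi> \<and>
    u \<in> laurent (residue_ring (int p)) \<and>
    gcd (int p) n = 1 \<and>
    laurent_at_one (residue_ring (int p)) u \<noteq> \<zero>\<^bsub>residue_ring (int p)\<^esub> \<and>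
    \<phi> lamp_a = \<alpha> \<and> \<phi> lamp_x = \<xi> \<and>
    \<alpha> = rooted_cycle p \<and>
    \<xi> = tree_node p
          (\<lambda>i. \<xi> [^]\<^bsub>tree_aut p\<^esub> n \<otimes>\<^bsub>tree_aut p\<^esub> laurent_pow (tree_aut p) \<alpha> \<xi> u [^]\<^bsub>tree_aut p\<^esub> i)
          id"
proof -
  interpret lamplighter_pair p H f t
    using assms by (intro lamplighter_pair.intro lamplighter.intro lamplighter_pair_axioms.intro)
  let ?\<phi> = "sc_rep L p ker split_f rep"
  have u: "f_unit \<in> base" by (intro f_base_closed dif_aug_ideal)
  have "aug f_unit mod int p \<noteq> 0"
    using aug_f_unit by (simp add: cong_def)
  then have "laurent_at_one (residue_ring (int p)) f_unit \<noteq> \<zero>\<^bsub>residue_ring (int p)\<^esub>"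
    by (simp add: laurent_at_one_residue_ring[OF u]) (simp add: residue_ring_def)
  note facts = this reducible_to_split laurent_residue_ring[OF u] coprime_f_top
    ker_rep_recursion[OF split_f_hom split_f_dif split_f_lamp_x]
  \<comment> \<open>The integer \<open>n\<close> is the action of \<open>f\<close> on the top group,
    and \<open>u\<close> is the image of \<open>x - 1\<close> under \<open>f\<close>.\<close>
  show ?thesis
    by (rule exI[of _ ?\<phi>], rule exI[of _ f_top], rule exI[of _ f_unit],
        rule exI[of _ "?\<phi> lamp_a"], rule exI[of _ "?\<phi> lamp_x"], intro conjI HOL.refl facts)
qed

end
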